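(* Let $p$ be an odd prime, let $m,\alpha$ be positive integers, and put $e=2m$, $q=p^{e}$, $d=\gcd(\alpha,e)$. Suppose that $\frac{m}{d}$ is even, and let $(a,c)\in\mathbb{F}_p^{*}\times\mathbb{F}_p^{*}$. Let $D=\{x\in\mathbb{F}_q: Tr(x^{p^{\alpha}+1})=a\}=\{d_1,\dots,d_n\}$ and let $$\mathcal{C}_D=\{(Tr(xd_1)+c,Tr(xd_2)+c,\dots,Tr(xd_n)+c): x\in\mathbb{F}_q\}.$$ Then $\mathcal{C}_D$ is a $[p^{e-1}+p^{m+d-1},\;e+1]$ linear code over $\mathbb{F}_p$ whose weight distribution is: - weight $(p-1)(p^{e-2}+p^{m+d-2})$ with multiplicity $p^{e}-p^{e-2d}$; - weight $(p-1)p^{e-2}+p^{m+d-1}$ with multiplicity $2p^{e-2d-1}-(p-2)p^{m-d-1}-1$; - weight $(p-1)p^{e-2}+2p^{m+d-1}$ with multiplicity $\frac12(p-3)(p^{e-2d-1}+p^{m-d-1})$; - weight $(p-1)p^{e-2}$ with multiplicity $\frac12(p-1)(p^{e-2d-1}+p^{m-d-1})$; - weight $p^{e-1}+p^{m+d-1}$ with multiplicity $1$; and whose complete weight enumerator is $$\begin{aligned}\mathit{CWE}(\mathcal{C}_{D})={}&w_{c}^{p^{e-1}+p^{m+d-1}}+(p^{e}-p^{e-2d})\prod_{0\le i\le p-1}w_{i}^{p^{e-2}+p^{m+d-2}}\\ &+\bigl(p^{e-2d-1}-(p-1)p^{m-d-1}-1\bigr)\,w_{c}^{p^{e-2}+p^{m+d-1}}\prod_{1\le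 i\le p-1}w_{i+c}^{p^{e-2}}\\ &+(p^{e-2d-1}+p^{m-d-1})\,w_{c}^{p^{e-2}-\left(\frac{-1}{p}\right)p^{m+d-1}}\prod_{1\le i\le p-1}w_{i+c}^{p^{e-2}-\left(\frac{i^{2}-c^{2}}{p}\right)p^{m+d-1}}\\ &+(p^{e-2d-1}+p^{m-d-1})\sum_{\substack{1\le i\le p-1\\ i\ne (4a)^{-1}c^{2}\\ \left(\frac{i}{p}\right)=\left(\frac{a}{p}\right)}}w_{c}^{p^{e-2}-\left(\frac{-1}{p}\right)p^{m+d-1}}\prod_{1\le j\le p-1}w_{j+c}^{p^{e-2}-\left(\frac{j^{2}-4ai}{p}\right)p^{m+d-1}}\\ &+(p^{e-2d-1}+p^{m-d-1})\sum_{\substack{1\le i\le p-1\\ \left(\frac{i}{p}\right)\ne\left(\frac{a}{p}\right)}}w_{c}^{p^{e-2}+\left(\frac{-1}{p}\right)p^{m+d-1}}\prod_{1\le j\le p-1}w_{j+c}^{p^{e-2}-\left(\frac{j^{2}-4ai}{p}\right)p^{m+d-1}},\end{aligned}$$ where the index of each unknown $w$ is reduced modulo $p$.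
   Context: $Tr$ denotes the trace function from $\mathbb{F}_q$ to $\mathbb{F}_p$, and $\left(\frac{*}{p}\right)$ is the Legendre symbol modulo $p$. An $[n,k]$ linear code over $\mathbb{F}_p$ is a $k$-dimensional subspace of $\mathbb{F}_p^{n}$. Elements of $\mathbb{F}_p$ are identified with $0,1,\dots,p-1$, and $(4a)^{-1}c^2$ is computed in $\mathbb{F}_p$. For a codeword $\mathbf{c}\in\mathbb{F}_p^{n}$, its complete weight enumerator is the monomial $w(\mathbf{c})=w_0^{t_0}w_1^{t_1}\cdots w_{p-1}^{t_{p-1}}$ in the unknowns $w_0,\dots,w_{p-1}$, where $t_i$ is the number of components of $\mathbf{c}$ equal to $i$; the complete weight enumerator of a code $\mathcal{C}$ is $\mathit{CWE}(\mathcal{C})=\sum_{\mathbf{c}\in\mathcal{C}}w(\mathbf{c})$. The weight distribution gives, for each Hamming weight, the number (multiplicity) of codewords having that weight.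
   Formalization: For fixed nonzero c, C_D has only p^e words and lacks the zero word, so it is not a linear code of dimension e+1; instead the linear span of C_D is shown to be a [p^(e-1)+p^(m+d-1), e+1] code, while the weight distribution and CWE are proved for C_D as displayed. *)

theory Defs
  imports
    "Berlekamp_Zassenhaus.Finite_Field"
    "Jordan_Normal_Form.DL_Rank"
    "HOL-Library.Poly_Mapping"
    "HOL-Number_Theory.Number_Theory"
begin

text \<open>
  The prime field with \<open>p\<close> elements is \<open>'p mod_ring\<close> with \<open>CARD('p) = p\<close>; the field with
  \<open>q = p ^ e\<close> elements is any finite field type \<open>'q\<close> of that cardinality.
\<close>

definition prime_field_emb :: "'p::prime_card mod_ring \<Rightarrow> 'q::field" where
  "prime_field_emb y = of_int (to_int_mod_ring y)"

text \<open>
  The value is determined because the sum lies in the prime subfield when \<open>'q\<close> has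
  \<open>CARD('p) ^ e\<close> elements; the definition is meant for that case only.
\<close>

definition field_trace :: "nat \<Rightarrow> 'q::field \<Rightarrow> 'p::prime_card mod_ring" where
  "field_trace e x = (THE y. prime_field_emb y = (\<Sum>i<e. x ^ (CARD('p) ^ i)))"

definition legendre :: "'p::prime_card mod_ring \<Rightarrow> int" where
  "legendre x = Legendre (to_int_mod_ring x) (int CARD('p))"

text \<open>
  For a fixed constant the words of \<open>code_D\<close> below form a translate of a linear code, with at
  most \<open>p ^ e\<close> words, so they cannot be a subspace of dimension \<open>e + 1\<close>. The linear code of
  dimension \<open>e + 1\<close> is the subspace they generate, where the constant runs over the whole
  prime field; weights and complete weight enumerator refer to the translate itself.
\<close>

definition code_span :: "nat \<Rightarrow> 'a::field vec set \<Rightarrow> 'a vec set" where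
  "code_span n C = LinearCombinations.module.span class_ring (module_vec TYPE('a) n) C"

definition linear_code :: "nat \<Rightarrow> nat \<Rightarrow> 'a::field vec set \<Rightarrow> bool" where
  "linear_code n k C \<longleftrightarrow>
     VectorSpace.subspace class_ring C (module_vec TYPE('a) n) \<and>
     vectorspace.dim class_ring ((module_vec TYPE('a) n)\<lparr>carrier := C\<rparr>) = k"

definition hamming_weight :: "'a::zero vec \<Rightarrow> nat" where
  "hamming_weight v = card {k. k < dim_vec v \<and> v $ k \<noteq> 0}"

text \<open>
  Multiplicities of rows of the table that list the same weight are added up, so rows may
  coincide for particular parameters; weights that are not listed do not occur.
\<close>

definition has_weight_distribution :: "'a::zero vec set \<Rightarrow> (nat \<times> rat) list \<Rightarrow> bool" where
  "has_weight_distribution C table \<longleftrightarrow>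
     (\<forall>w. of_nat (card {v \<in> C. hamming_weight v = w}) =
        (\<Sum>(u, mult) \<leftarrow> table. if u = w then mult else 0))"

text \<open>
  Integer polynomials in unknowns indexed by the elements of \<open>'a\<close>: monomials are finitely
  supported exponent functions. For \<open>'a = 'p mod_ring\<close>, the index of an unknown is thereby
  automatically reduced modulo \<open>p\<close>.
\<close>

type_synonym 'a enumerator = "('a \<Rightarrow>\<^sub>0 nat) \<Rightarrow>\<^sub>0 int"

definition unknown :: "'a \<Rightarrow> 'a enumerator" where
  "unknown i = Poly_Mapping.single (Poly_Mapping.single i 1) 1"

definition cwe_word :: "'a::finite vec \<Rightarrow> 'a enumerator" where
  "cwe_word v = (\<Prod>i\<in>UNIV. unknown i ^ card {k. k < dim_vec v \<and> v $ k = i})"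

definition CWE :: "'a::finite vec set \<Rightarrow> 'a enumerator" where
  "CWE C = (\<Sum>v\<in>C. cwe_word v)"

definition defining_set :: "nat \<Rightarrow> nat \<Rightarrow> 'p::prime_card mod_ring \<Rightarrow> 'q::field set" where
  "defining_set e \<alpha> a = {x. field_trace e (x ^ (CARD('p) ^ \<alpha> + 1)) = a}"

text \<open>The list \<open>ds\<close> is the enumeration \<open>d\<^sub>1, \<dots>, d\<^sub>n\<close> of the defining set.\<close>

definition code_D :: "nat \<Rightarrow> 'q::field list \<Rightarrow> 'p::prime_card mod_ring \<Rightarrow> 'p mod_ring vec set" where
  "code_D e ds c = range (\<lambda>x. vec_of_list (map (\<lambda>y. field_trace e (x * y) + c) ds))"

end

theory Submission
  imports Defs
begin

text \<open>
  Write \<open>Q x = Tr (x ^ (p ^ \<alpha> + 1))\<close>. This is a quadratic form over the prime field with polar form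
  \<open>Tr (L x * y)\<close> for an additive map \<open>L\<close> whose kernel \<open>R\<close> has \<open>p ^ (2 * d)\<close> elements. Every
  \<open>v \<noteq> 0\<close> is a norm \<open>\<kappa> ^ (p ^ d + 1)\<close> with \<open>Q (\<kappa> * x) = v * Q x\<close>, so all nonzero levels of \<open>Q\<close>
  have the same size. Counting the pairs with \<open>Q x = Q y\<close> gives \<open>(N 0 - N 1)\<^sup>2 = p ^ (e + 2 * d)\<close>, and
  the sign is read off modulo \<open>p ^ d + 1\<close> from the free action of the elements of norm 1.

  The functional \<open>Tr (x * y)\<close> is nonconstant on \<open>R\<close> unless \<open>x = L z\<close>; in the first case it is
  equidistributed on \<open>Q y = a\<close>. If \<open>x = L z\<close> with \<open>Q z = 0\<close>, translating by multiples of \<open>z\<close>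
  gives the joint distribution of \<open>Q y\<close> and \<open>Tr (x * y)\<close>. If \<open>v = Q z \<noteq> 0\<close>, splitting off the line
  through \<open>z\<close> reduces it to the level sizes of \<open>Q\<close> on the hyperplane \<open>Tr (x * y) = 0\<close>; these are
  invariant under scaling by squares, hence determined by \<open>N 0\<close>, \<open>N v\<close> and their total.
\<close>

section \<open>The Legendre symbol on the prime field\<close>

lemma of_int_to_int_mod_ring: "of_int (to_int_mod_ring y) = (y :: 'p::prime_card mod_ring)"
  by (simp add: of_int_of_int_mod_ring)

lemma to_int_mod_ring_cong_iff:
  "[i = to_int_mod_ring x] (mod int CARD('p)) \<longleftrightarrow> of_int i = (x :: 'p::prime_card mod_ring)"
proof -
  have "of_int (to_int_mod_ring x) = x" by (simp add: of_int_of_int_mod_ring)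
  thus ?thesis using of_int_eq_iff_cong_CHAR[of i "to_int_mod_ring x", where 'a="'p mod_ring"] by simp
qed

lemma legendre_eq:
  "legendre (x :: 'p::prime_card mod_ring) = (if x = 0 then 0 else if \<exists>y. y\<^sup>2 = x then 1 else -1)"
proof -
  have "[to_int_mod_ring x = 0] (mod int CARD('p)) \<longleftrightarrow> x = 0"
    using to_int_mod_ring_cong_iff[of 0 x] by (auto simp: cong_sym_eq)
  moreover have "QuadRes (int CARD('p)) (to_int_mod_ring x) \<longleftrightarrow> (\<exists>y. y\<^sup>2 = x)"
  proof
    assume "QuadRes (int CARD('p)) (to_int_mod_ring x)"
    then obtain i where "of_int (i\<^sup>2) = x" unfolding QuadRes_def to_int_mod_ring_cong_iff by blast
    thus "\<exists>y. y\<^sup>2 = x" by (intro exI[of _ "of_int i"]) simp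
  next
    assume "\<exists>y. y\<^sup>2 = x"
    then obtain y where y: "y\<^sup>2 = x" by blast
    have "of_int ((to_int_mod_ring y)\<^sup>2) = x" unfolding of_int_power of_int_to_int_mod_ring by (rule y)
    thus "QuadRes (int CARD('p)) (to_int_mod_ring x)" unfolding QuadRes_def to_int_mod_ring_cong_iff by blast
  qed
  ultimately show ?thesis by (simp add: legendre_def Legendre_def)
qed

lemma legendre_0 [simp]: "legendre 0 = 0" by (simp add: legendre_eq)
lemma legendre_eq_0_iff [simp]: "legendre x = 0 \<longleftrightarrow> x = 0" by (simp add: legendre_eq)
lemma legendre_square: "x \<noteq> 0 \<Longrightarrow> legendre (x\<^sup>2) = 1" by (auto simp: legendre_eq)
lemma legendre_1 [simp]: "legendre 1 = 1" using legendre_square[of 1] by simp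
lemma legendre_cases: "legendre x = -1 \<or> legendre x = 0 \<or> legendre x = 1" by (simp add: legendre_eq)

locale odd_prime_field =
  fixes prime_type :: "'p::prime_card itself"
  assumes odd_card: "odd CARD('p)"
begin

lemma card_gt_2: "CARD('p) > 2"
  using prime_card[where 'a='p] prime_ge_2_nat[of "CARD('p)"] odd_card by (cases "CARD('p) = 2") auto

lemma of_int_neq_0: "\<bar>i\<bar> \<le> 2 \<Longrightarrow> i \<noteq> 0 \<Longrightarrow> (of_int i :: 'p mod_ring) \<noteq> 0"
proof
  assume i: "\<bar>i\<bar> \<le> 2" "i \<noteq> 0" "(of_int i :: 'p mod_ring) = 0"
  hence "int CARD('p) dvd i"
    using of_int_eq_0_iff_char_dvd[of i, where 'a="'p mod_ring"] by simp
  hence "int CARD('p) \<le> \<bar>i\<bar>" using i by (metis dvd_imp_le_int of_nat_0_le_iff abs_of_nonneg)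
  thus False using i card_gt_2 by linarith
qed

lemma two_neq_0: "(2 :: 'p mod_ring) \<noteq> 0"
  using of_int_neq_0[of 2] by simp

lemma four_mult_neq_0: "v \<noteq> 0 \<Longrightarrow> 4 * v \<noteq> (0 :: 'p mod_ring)"
  using two_neq_0 by (metis mult_2 mult_eq_0_iff numeral_Bit0)

lemma of_int_legendre: "of_int (legendre x) = (x :: 'p mod_ring) ^ ((CARD('p) - 1) div 2)"
proof -
  have "[legendre x = to_int_mod_ring x ^ ((CARD('p) - 1) div 2)] (mod int CARD('p))"
    unfolding legendre_def by (rule euler_criterion[OF prime_card card_gt_2])
  hence "(of_int (legendre x) :: 'p mod_ring) = of_int (to_int_mod_ring x ^ ((CARD('p) - 1) div 2))"
    by (simp only: of_int_eq_iff_cong_CHAR semiring_char_mod_ring)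
  thus ?thesis by (simp only: of_int_power of_int_to_int_mod_ring)
qed

text \<open>By Euler's criterion both sides agree in the field. Two integers in {-1, 0, 1} differ by
  at most 2, and no nonzero integer that small is divisible by an odd prime.\<close>

lemma legendre_mult: "legendre (x * y) = legendre x * legendre (y :: 'p mod_ring)"
proof (rule ccontr)
  assume *: "\<not> ?thesis"
  have "of_int (legendre (x * y) - legendre x * legendre y) = (0 :: 'p mod_ring)"
    by (simp add: of_int_legendre power_mult_distrib)
  moreover have "\<bar>legendre (x * y) - legendre x * legendre y\<bar> \<le> 2"
    using legendre_cases[of "x * y"] legendre_cases[of x] legendre_cases[of y] by auto
  ultimately show False using of_int_neq_0[of "legendre (x * y) - legendre x * legendre y"] * by linarith
qed

section \<open>Numbers of square roots and sums of Legendre symbols\<close>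

lemma card_sqrt: "int (card {y. y\<^sup>2 = x}) = 1 + legendre (x :: 'p mod_ring)"
proof (cases "\<exists>y. y\<^sup>2 = x")
  case True
  then obtain z where z: "z\<^sup>2 = x" by blast
  have "{y. y\<^sup>2 = x} = {z, -z}" unfolding z[symmetric] by (auto simp: power2_eq_iff)
  moreover have "z \<noteq> - z" if "z \<noteq> 0"
  proof
    assume "z = - z"
    hence "z + z = 0" by (metis add.right_inverse)
    hence "2 * z = 0" by (simp only: mult_2)
    thus False using that two_neq_0 by simp
  qed
  ultimately show ?thesis using z True by (cases "z = 0") (auto simp: legendre_eq)
qed (auto simp: legendre_eq)

lemma sum_legendre: "(\<Sum>x\<in>UNIV. legendre (x :: 'p mod_ring)) = 0"
proof -
  have "int CARD('p) + (\<Sum>x\<in>UNIV. legendre (x :: 'p mod_ring)) = (\<Sum>x\<in>UNIV. 1 + legendre (x :: 'p mod_ring))"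
    by (simp add: sum.distrib)
  also have "\<dots> = int (\<Sum>x\<in>UNIV. card {y. y\<^sup>2 = (x :: 'p mod_ring)})"
    unfolding of_nat_sum card_sqrt ..
  also have "(\<Sum>x\<in>UNIV. card {y. y\<^sup>2 = (x :: 'p mod_ring)}) = card (\<Union>x\<in>UNIV. {y. y\<^sup>2 = (x :: 'p mod_ring)})"
    by (rule card_UN_disjoint[symmetric]) auto
  also have "(\<Union>x\<in>UNIV. {y. y\<^sup>2 = (x :: 'p mod_ring)}) = UNIV" by auto
  finally show ?thesis by simp
qed

text \<open>On the values -1, 0, 1 the function \<open>g\<close> is affine up to a correction at 0;
  the affine part is summed with \<open>sum_legendre\<close>.\<close>

lemma sum_legendre_comp:
  fixes g :: "int \<Rightarrow> rat"
  shows "(\<Sum>x\<in>UNIV. g (legendre (x :: 'p mod_ring))) = g 0 + (of_nat CARD('p) - 1) / 2 * (g 1 + g (-1))"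
proof -
  have g: "g (legendre x) = (g 1 + g (-1)) / 2 + (g 1 - g (-1)) / 2 * of_int (legendre x) 
      + (if x = 0 then g 0 - (g 1 + g (-1)) / 2 else 0)" for x :: "'p mod_ring"
    using legendre_cases[of x] by (auto simp: field_simps)
  have "(\<Sum>x\<in>UNIV. g (legendre (x :: 'p mod_ring))) = 
     of_nat CARD('p) * ((g 1 + g (-1)) / 2) + (g 1 - g (-1)) / 2 * of_int (\<Sum>x\<in>UNIV. legendre (x :: 'p mod_ring))
      + (g 0 - (g 1 + g (-1)) / 2)"
    by (subst sum.cong[OF refl g]) (simp_all add: sum.distrib sum_distrib_left)
  thus ?thesis unfolding sum_legendre by (simp add: field_simps)
qed

text \<open>The points of the hyperbola \<open>u\<^sup>2 - w\<^sup>2 = 1\<close> are parametrised by \<open>t = u + w \<noteq> 0\<close>.\<close>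

lemma sum_legendre_square_minus_1: "(\<Sum>u\<in>UNIV. legendre (u\<^sup>2 - 1 :: 'p mod_ring)) = -1"
proof -
  let ?H = "SIGMA u:UNIV. {w. w\<^sup>2 = (u\<^sup>2 - 1 :: 'p mod_ring)}"
  have "bij_betw (\<lambda>t. ((t + 1 / t) / 2, (t - 1 / t) / 2)) (UNIV - {0}) ?H"
  proof (rule bij_betwI[of _ _ _ "\<lambda>(u, w). u + w"])
    show "(\<lambda>t. ((t + 1 / t) / 2, (t - 1 / t) / 2)) \<in> UNIV - {0} \<rightarrow> ?H"
    proof
      fix t :: "'p mod_ring" assume t: "t \<in> UNIV - {0}"
      define u w where "u = (t + 1 / t) / 2" and "w = (t - 1 / t) / 2"
      have "u + w = (2 * t) / 2" "u - w = (2 * (1 / t)) / 2"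
        by (simp_all add: u_def w_def add_divide_distrib[symmetric] diff_divide_distrib[symmetric])
      hence "u + w = t" "u - w = 1 / t" using two_neq_0 by simp_all
      hence "(u + w) * (u - w) = 1" using t by simp
      hence "w\<^sup>2 = u\<^sup>2 - 1" by (simp add: power2_eq_square algebra_simps)
      thus "((t + 1 / t) / 2, (t - 1 / t) / 2) \<in> ?H" by (simp add: u_def w_def)
    qed
    show "(\<lambda>(u, w). u + w) \<in> ?H \<rightarrow> UNIV - {0}"
    proof
      fix z assume "z \<in> ?H"
      then obtain u w where z: "z = (u, w)" "w\<^sup>2 = u\<^sup>2 - 1" by auto
      hence "(u + w) * (u - w) = 1" by (simp add: power2_eq_square algebra_simps)
      thus "(case z of (u, w) \<Rightarrow> u + w) \<in> UNIV - {0}" using z by auto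
    qed
    show "(case ((t + 1 / t) / 2, (t - 1 / t) / 2) of (u, w) \<Rightarrow> u + w) = t" for t :: "'p mod_ring"
    proof -
      have "(t + 1 / t) / 2 + (t - 1 / t) / 2 = (2 * t) / 2" by (simp add: add_divide_distrib[symmetric])
      thus ?thesis using two_neq_0 by simp
    qed
    show "(((case z of (u, w) \<Rightarrow> u + w) + 1 / (case z of (u, w) \<Rightarrow> u + w)) / 2,
           ((case z of (u, w) \<Rightarrow> u + w) - 1 / (case z of (u, w) \<Rightarrow> u + w)) / 2) = z" if "z \<in> ?H" for z
    proof -
      obtain u w where zuw: "z = (u, w)" by (cases z)
      hence z: "z = (u, w)" "w\<^sup>2 = u\<^sup>2 - 1" using that by auto
      hence "(u + w) * (u - w) = 1" by (simp add: power2_eq_square algebra_simps)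
      hence "1 / (u + w) = u - w" by (metis divide_eq_eq mult.commute mult_zero_left zero_neq_one)
      moreover have "(u + w + (u - w)) / 2 = u" "(u + w - (u - w)) / 2 = w"
        using two_neq_0 by (simp_all add: field_simps)
      ultimately show ?thesis using z by simp
    qed
  qed
  from bij_betw_same_card[OF this, symmetric]
  have "card ?H = card (UNIV - {0 :: 'p mod_ring})" .
  hence "int (\<Sum>u\<in>UNIV. card {w. w\<^sup>2 = (u\<^sup>2 - 1 :: 'p mod_ring)}) = int CARD('p) - 1"
    using card_gt_2 by (simp add: card_Diff_singleton of_nat_diff)
  hence "(\<Sum>u\<in>UNIV. 1 + legendre (u\<^sup>2 - 1 :: 'p mod_ring)) = int CARD('p) - 1"
    unfolding of_nat_sum card_sqrt .
  thus ?thesis by (simp add: sum.distrib)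
qed

section \<open>Functions invariant under scaling by squares\<close>

lemma exists_nonsquare: "\<exists>g :: 'p mod_ring. legendre g = -1"
proof (rule ccontr)
  assume *: "\<nexists>g :: 'p mod_ring. legendre g = -1"
  have "(\<Sum>x\<in>UNIV. legendre (x :: 'p mod_ring)) \<ge> (\<Sum>x\<in>{1}. legendre (x :: 'p mod_ring))"
    proof (rule sum_mono2)
    show "0 \<le> legendre x" for x :: "'p mod_ring" using * legendre_cases[of x] by auto
  qed auto
  thus False using sum_legendre by simp
qed

lemma legendre_eq_1D:
  assumes "legendre (x :: 'p mod_ring) = 1"
  shows "\<exists>k. k \<noteq> 0 \<and> x = k\<^sup>2"
proof -
  have "x \<noteq> 0" "\<exists>k. k\<^sup>2 = x" using assms by (auto simp: legendre_eq split: if_splits)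
  thus ?thesis by auto
qed

text \<open>Invariance leaves three unknown values: at 0, at 1 and at one nonsquare
  \<open>g\<close>. The three sums are linear equations that determine them. This will be applied to
  level sizes on a hyperplane.\<close>

lemma square_invariant_unique:
  fixes P :: "'p mod_ring \<Rightarrow> int"
  assumes inv: "\<And>k w. k \<noteq> 0 \<Longrightarrow> P (k\<^sup>2 * w) = P w"
    and sq: "(\<Sum>u\<in>UNIV. P (u\<^sup>2)) = int CARD('p) * t - (int CARD('p) - 1) * K"
    and sq1: "(\<Sum>u\<in>UNIV. P (u\<^sup>2 - 1)) = int CARD('p) * t + K"
    and all: "(\<Sum>w\<in>UNIV. P w) = int CARD('p) * t"
  shows "P w = t - legendre w * K"
proof -
  obtain g :: "'p mod_ring" where g: "legendre g = -1" using exists_nonsquare by blast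
  have g0: "g \<noteq> 0" using g by auto
  let ?P = "int CARD('p)"
  define s \<delta> where "s = P 1 + P g" and "\<delta> = P 1 - P g"
  have sqP: "P w = P 1" if "legendre w = 1" for w
    using legendre_eq_1D[OF that] inv[of _ 1] by auto
  have nsqP: "P w = P g" if "legendre w = -1" for w
  proof -
    have "legendre (w * g) = 1" using that g by (simp add: legendre_mult)
    then obtain k where k: "k \<noteq> 0" "w * g = k\<^sup>2" using legendre_eq_1D by blast
    have "w = (k / g)\<^sup>2 * g" using k g0 by (simp add: power2_eq_square field_simps)
    thus ?thesis using inv[of "k / g" g] k g0 by simp
  qed
  \<comment> \<open>Interpolation between the values at squares and at nonsquares, doubled to avoid
    division in the integers.\<close>
  have P: "2 * P w = s + \<delta> * legendre w + (if w = 0 then 2 * P 0 - s else 0)" for w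
    using legendre_cases[of w] sqP[of w] nsqP[of w] by (auto simp: s_def \<delta>_def)
  have "(\<Sum>u\<in>UNIV. P (u\<^sup>2)) = P 0 + (\<Sum>u\<in>UNIV - {0}. P (u\<^sup>2))"
    by (subst sum.remove[of _ 0]) auto
  also have "(\<Sum>u\<in>UNIV - {0}. P (u\<^sup>2)) = (\<Sum>u\<in>UNIV - {0 :: 'p mod_ring}. P 1)"
    by (rule sum.cong) (auto intro!: sqP legendre_square)
  also have "\<dots> = (?P - 1) * P 1" using card_gt_2 by (simp add: card_Diff_singleton of_nat_diff)
  finally have e1: "P 0 + (?P - 1) * P 1 = ?P * t - (?P - 1) * K" using sq by simp
  have "2 * (\<Sum>u\<in>UNIV. P (u\<^sup>2 - 1)) = (\<Sum>u\<in>UNIV. s + \<delta> * legendre (u\<^sup>2 - 1 :: 'p mod_ring) + (if u\<^sup>2 - 1 = 0 then 2 * P 0 - s else 0))"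
    unfolding sum_distrib_left by (intro sum.cong refl P)
  also have "\<dots> = ?P * s + \<delta> * (\<Sum>u\<in>UNIV. legendre (u\<^sup>2 - 1 :: 'p mod_ring)) 
     + (\<Sum>u\<in>UNIV. if u\<^sup>2 - 1 = (0 :: 'p mod_ring) then 2 * P 0 - s else 0)"
    by (simp add: sum.distrib sum_distrib_left)
  also have "(\<Sum>u\<in>UNIV. if u\<^sup>2 - 1 = (0 :: 'p mod_ring) then 2 * P 0 - s else 0) =
     int (card {u. u\<^sup>2 = (1 :: 'p mod_ring)}) * (2 * P 0 - s)"
    by (simp add: sum.If_cases)
  finally have e2: "2 * (?P * t + K) = ?P * s - \<delta> + 2 * (2 * P 0 - s)"
    unfolding sum_legendre_square_minus_1 card_sqrt sq1 by simp
  have "2 * (\<Sum>w\<in>UNIV. P w) = (\<Sum>w\<in>UNIV. s + \<delta> * legendre (w :: 'p mod_ring) + (if w = 0 then 2 * P 0 - s else 0))"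
    unfolding sum_distrib_left by (intro sum.cong refl P)
  also have "\<dots> = ?P * s + \<delta> * (\<Sum>w\<in>UNIV. legendre (w :: 'p mod_ring)) + (2 * P 0 - s)"
    by (simp add: sum.distrib sum_distrib_left)
  finally have e3: "2 * (?P * t) = ?P * s + (2 * P 0 - s)"
    unfolding sum_legendre all by simp
  \<comment> \<open>Subtracting \<open>e3\<close> from \<open>e2\<close> leaves
    \<open>2 * K = 2 * P 0 - (s + \<delta>)\<close>, and \<open>s + \<delta>\<close> is
    \<open>2 * P 1\<close>.\<close>
  have P01: "P 0 = P 1 + K" using e2 e3 by (simp add: s_def \<delta>_def)
  have "?P * P 1 = ?P * (t - K)" using e1 unfolding P01 by (simp add: algebra_simps)
  hence P1: "P 1 = t - K" by simp
  hence P0: "P 0 = t" using P01 by simp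
  have "(?P - 1) * s = (?P - 1) * (2 * t)" using e3 unfolding P0 by (simp add: algebra_simps)
  moreover have "?P - 1 \<noteq> 0" using card_gt_2 by simp
  ultimately have "s = 2 * t" by (metis mult_left_cancel)
  hence Pg: "P g = t + K" using P1 by (simp add: s_def)
  show ?thesis using legendre_cases[of w] sqP[of w] nsqP[of w] P0 P1 Pg by auto
qed

end

section \<open>Extensions of the prime field and the trace\<close>

lemma card_field_gt_1: "CARD('q::{finite,field}) > 1"
proof -
  have "card {0, 1::'q} \<le> CARD('q)" by (intro card_mono) auto
  thus ?thesis by simp
qed

text \<open>Multiplication by \<open>x\<close> permutes the nonzero elements and hence preserves
  their product.\<close>

lemma finite_field_power_card_minus_1:
  fixes x :: "'q::{finite,field}"
  assumes "x \<noteq> 0"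
  shows "x ^ (CARD('q) - 1) = 1"
proof -
  have "(\<Prod>y\<in>UNIV-{0}. x * y) = (\<Prod>y\<in>UNIV-{0}. y)"
    by (rule prod.reindex_bij_witness[of _ "\<lambda>y. y / x" "\<lambda>y. x * y"]) (use assms in auto)
  hence "x ^ (CARD('q) - 1) * (\<Prod>y\<in>UNIV-{0::'q}. y) = 1 * (\<Prod>y\<in>UNIV-{0}. y)"
    by (simp add: prod.distrib card_Diff_singleton)
  moreover have "(\<Prod>y\<in>UNIV-{0::'q}. y) \<noteq> 0" by simp
  ultimately show ?thesis by (metis mult_right_cancel)
qed

lemma finite_field_power_card:
  fixes x :: "'q::{finite,field}"
  shows "x ^ CARD('q) = x"
proof (cases "x = 0")
  case False
  have "x ^ CARD('q) = x * x ^ (CARD('q) - 1)"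
    by (metis finite_UNIV_card_ge_0 finite_class.finite_UNIV power_eq_if not_gr_zero)
  thus ?thesis using finite_field_power_card_minus_1[OF False] by simp
qed (simp add: power_0_left)

text \<open>
  The polynomial \<open>X ^ (n * N) - 1\<close> splits into distinct linear factors and is divisible by
  \<open>X ^ n - y\<close>, which therefore splits as well.
\<close>

lemma card_nth_roots_finite_field:
  fixes y :: "'q::{finite,field}"
  assumes nN: "n * N = CARD('q) - 1" and y: "y ^ N = 1"
  shows "card {x::'q. x ^ n = y} = n"
proof -
  have pos: "n * N > 0" using nN card_field_gt_1[where 'q='q] by auto
  hence pos': "n > 0" "N > 0" by auto
  have y0: "y \<noteq> 0" using y pos by (auto simp: power_0_left)
  define f where "f = Polynomial.monom (1::'q) n - [:y:]"
  define g where "g = (\<Sum>i<N. [:y:] ^ (N - Suc i) * Polynomial.monom (1::'q) n ^ i)"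
  have fg: "poly f x * poly g x = x ^ (n * N) - 1" for x
  proof -
    have "poly f x * poly g x = (x ^ n - y) * (\<Sum>i<N. y ^ (N - Suc i) * (x ^ n) ^ i)"
      by (simp add: f_def g_def poly_sum poly_monom)
    also have "\<dots> = (x ^ n) ^ N - y ^ N" by (rule power_diff_sumr2[symmetric])
    finally show ?thesis by (simp add: y power_mult)
  qed
  have f0: "f \<noteq> 0"
  proof
    assume "f = 0"
    hence "poly f 0 = 0" by simp
    thus False using y0 pos' by (simp add: f_def poly_monom power_0_left)
  qed
  have g0: "g \<noteq> 0"
  proof
    assume "g = 0"
    hence "poly f 0 * poly g 0 = 0" by simp
    thus False using pos' unfolding fg by (simp add: power_0_left)
  qed
  have degf: "degree f \<le> n" unfolding f_def by (intro degree_diff_le) (auto simp: degree_monom_le)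
  have degg: "degree g \<le> n * (N - 1)" unfolding g_def
  proof (intro degree_sum_le)
    fix i assume i: "i \<in> {..<N}"
    have "degree ([:y:] ^ (N - Suc i) * Polynomial.monom 1 n ^ i) \<le> 
          degree ([:y:] ^ (N - Suc i)) + degree (Polynomial.monom (1::'q) n ^ i)" by (rule degree_mult_le)
    also have "\<dots> \<le> 0 + n * i"
      by (intro add_mono) (use degree_power_le[of "[:y:]" "N - Suc i"] in \<open>auto simp: monom_power degree_monom_le mult.commute\<close>)
    also have "\<dots> \<le> n * (N - 1)" using i by auto
    finally show "degree ([:y:] ^ (N - Suc i) * Polynomial.monom 1 n ^ i) \<le> n * (N - 1)" by simp
  qed auto
  \<comment> \<open>The \<open>n * N\<close> nonzero elements are shared between the roots of
    \<open>f\<close> and the at most \<open>n * (N - 1)\<close> roots of \<open>g\<close>, so at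
    least \<open>n\<close> are left for \<open>f\<close>.\<close>
  have "UNIV - {0} \<subseteq> {x. poly f x = 0} \<union> {x. poly g x = 0}"
  proof
    fix x :: 'q assume "x \<in> UNIV - {0}"
    hence "x ^ (n * N) = 1" unfolding nN by (intro finite_field_power_card_minus_1) auto
    hence "poly f x * poly g x = 0" using fg by simp
    thus "x \<in> {x. poly f x = 0} \<union> {x. poly g x = 0}" by auto
  qed
  hence "card (UNIV - {0::'q}) \<le> card ({x. poly f x = 0} \<union> {x. poly g x = 0})"
    by (intro card_mono) auto
  also have "\<dots> \<le> card {x. poly f x = 0} + card {x. poly g x = 0}" by (rule card_Un_le)
  also have "\<dots> \<le> card {x. poly f x = 0} + n * (N - 1)"
    using card_poly_roots_bound[OF g0] degg by simp
  finally have "n * N \<le> card {x. poly f x = 0} + n * (N - 1)" using nN by (simp add: card_Diff_singleton)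
  moreover have "n * N = n + n * (N - 1)" using pos' by (cases N) auto
  ultimately have "n \<le> card {x. poly f x = 0}" by simp
  moreover have "card {x. poly f x = 0} \<le> n" using card_poly_roots_bound[OF f0] degf by simp
  moreover have "{x. poly f x = 0} = {x. x ^ n = y}" by (auto simp: f_def poly_monom)
  ultimately show ?thesis by simp
qed

section \<open>The prime subfield, Frobenius powers and the trace\<close>

locale finite_field_extension =
  fixes p e :: nat and prime_type :: "'p::prime_card itself" and ext_type :: "'q::{finite,field} itself"
  assumes card_p: "CARD('p) = p" and card_ext: "CARD('q) = p ^ e"
begin

abbreviation emb :: "'p mod_ring \<Rightarrow> 'q" where "emb \<equiv> prime_field_emb"
abbreviation tr :: "'q \<Rightarrow> 'p mod_ring" where "tr \<equiv> field_trace e"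

lemma prime_p: "prime p" using prime_card[where 'a='p] card_p by simp

lemma p_gt_1: "p > 1" using prime_p prime_gt_1_nat by blast

lemma p_pos: "p > 0" using p_gt_1 by simp

lemma e_pos: "e > 0"
  using card_field_gt_1[where 'q='q] card_ext by (cases e) auto

lemma char_ext: "CHAR('q) = p"
proof -
  have "CHAR('q) > 0" by (rule finite_imp_CHAR_pos) auto
  hence "prime CHAR('q)" by (rule prime_CHAR_semidom)
  moreover have "CHAR('q) dvd p ^ e" using CHAR_dvd_CARD[where 'a='q] card_ext by simp
  ultimately show ?thesis by (metis prime_dvd_power primes_dvd_imp_eq prime_p)
qed

text \<open>The representative chosen for \<open>of_int n\<close> is \<open>n mod int p\<close>;
  passing to it is harmless because the extension has characteristic \<open>p\<close>. The ring laws
  for \<open>emb\<close> are then pulled back to the integers.\<close>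

lemma emb_of_int [simp]: "emb (of_int n) = of_int n"
proof -
  have "to_int_mod_ring (of_int n :: 'p mod_ring) = n mod int p"
    unfolding of_int_of_int_mod_ring card_p[symmetric] by transfer simp
  moreover have "(of_int (n mod int p) :: 'q) = of_int n"
    by (simp add: of_int_eq_iff_cong_CHAR char_ext)
  ultimately show ?thesis by (simp add: prime_field_emb_def)
qed

lemma emb_hom [simp]:
  "emb 0 = 0" "emb 1 = 1"
  "emb (x + y) = emb x + emb y" "emb (x - y) = emb x - emb y" 
  "emb (x * y) = emb x * emb y" "emb (- x) = - emb x"
proof -
  define i j where "i = to_int_mod_ring x" and "j = to_int_mod_ring y"
  have x: "x = of_int i" and y: "y = of_int j" by (simp_all only: i_def j_def of_int_to_int_mod_ring)
  show "emb (x + y) = emb x + emb y" "emb (x - y) = emb x - emb y" 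
    "emb (x * y) = emb x * emb y" "emb (- x) = - emb x"
    unfolding x y by (simp_all flip: of_int_add of_int_mult of_int_diff of_int_minus del: of_int_add of_int_mult of_int_diff of_int_minus)
qed (use emb_of_int[of 0] emb_of_int[of 1] in simp_all)

lemma emb_power [simp]: "emb (x ^ n) = emb x ^ n"
  by (induction n) auto

lemma emb_eq_0_iff [simp]: "emb x = 0 \<longleftrightarrow> x = 0"
proof
  assume "emb x = 0"
  hence "(of_int (to_int_mod_ring x) :: 'q) = of_int 0" by (simp add: prime_field_emb_def)
  hence "(of_int (to_int_mod_ring x) :: 'p mod_ring) = of_int 0"
    by (simp only: of_int_eq_iff_cong_CHAR char_ext semiring_char_mod_ring card_p)
  thus "x = 0" by (simp only: of_int_to_int_mod_ring of_int_0)
qed simp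

lemma emb_eq_iff [simp]: "emb x = emb y \<longleftrightarrow> x = y"
  using emb_eq_0_iff[of "x - y"] by (simp del: emb_eq_0_iff)

lemma mod_ring_power_card: "(y :: 'p mod_ring) ^ p ^ k = y"
  by (induction k) (use finite_field_power_card[of y] in \<open>simp_all add: card_p power_mult mult.commute\<close>)

lemma emb_power_card: "emb y ^ p ^ k = emb y"
  using mod_ring_power_card[of y k] by (metis emb_power)

text \<open>The polynomial \<open>X ^ p - X\<close> has at most \<open>p\<close> roots, and the
  \<open>p\<close> values of \<open>emb\<close> already are roots.\<close>

lemma range_emb: 
  assumes "x ^ p = x"
  shows "x \<in> range emb"
proof -
  define f where "f = Polynomial.monom (1::'q) p - [:0, 1:]"
  have "Polynomial.coeff f p = 1" using p_gt_1 by (auto simp: f_def coeff_pCons split: nat.splits)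
  hence f0: "f \<noteq> 0" by auto
  have roots: "{x. poly f x = 0} = {x. x ^ p = x}" by (auto simp: f_def poly_monom)
  have "degree f \<le> p" unfolding f_def using p_gt_1 by (intro degree_diff_le) (auto simp: degree_monom_le)
  hence "card {x::'q. x ^ p = x} \<le> p" using card_poly_roots_bound[OF f0] roots by simp
  moreover have "range emb \<subseteq> {x. x ^ p = x}" using emb_power_card[of _ 1] by (auto simp del: power_one_right simp: )
  moreover have "card (range emb) = p" by (subst card_image) (auto intro!: injI simp: card_p)
  ultimately have "range emb = {x. x ^ p = x}" by (intro card_seteq) auto
  thus ?thesis using assms by simp
qed

lemma frob_add: "((x::'q) + y) ^ p ^ k = x ^ p ^ k + y ^ p ^ k"
  using freshmans_dream'[of "p ^ k" k x y] char_ext prime_p by simp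

lemma frob_uminus: "(- (x::'q)) ^ p ^ k = - (x ^ p ^ k)"
proof -
  have "x ^ p ^ k + (- x) ^ p ^ k = 0" using frob_add[of x "-x" k] p_pos by (simp add: power_0_left)
  thus ?thesis by (simp add: add_eq_0_iff)
qed

lemma frob_diff: "((x::'q) - y) ^ p ^ k = x ^ p ^ k - y ^ p ^ k"
  using frob_add[of x "-y" k] by (simp add: frob_uminus)

lemma frob_sum: "(\<Sum>i\<in>A. f i :: 'q) ^ p ^ k = (\<Sum>i\<in>A. f i ^ p ^ k)"
  using freshmans_dream_sum'[of "p ^ k" k f A] char_ext prime_p by simp

lemma frob_frob: "((x::'q) ^ p ^ i) ^ p ^ j = x ^ p ^ (i + j)"
  by (simp add: power_add power_mult)

lemma frob_e: "(x::'q) ^ p ^ e = x"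
  using finite_field_power_card[of x] card_ext by simp

lemma frob_mult_e: "(x::'q) ^ p ^ (e * k) = x"
  by (induction k) (simp_all add: frob_e flip: frob_frob)

text \<open>Raising to the power \<open>p\<close> permutes the terms of the sum cyclically. The sum
  is therefore fixed by Frobenius and lies in the prime subfield, which makes the definite
  description in \<open>field_trace\<close> meaningful.\<close>

lemma emb_tr: "emb (tr x) = (\<Sum>i<e. x ^ p ^ i)"
proof -
  have "(\<Sum>i<e. x ^ p ^ i) ^ p = (\<Sum>i<e. x ^ p ^ Suc i)"
    using frob_sum[of "\<lambda>i. x ^ p ^ i" "{..<e}" 1] by (simp add: mult.commute flip: power_mult)
  also have "\<dots> = (\<Sum>i<e. x ^ p ^ i)"
    using sum.lessThan_Suc_shift[of "\<lambda>i. x ^ p ^ i" e] frob_e[of x] by (simp add: mult.commute)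
  finally obtain y where y: "(\<Sum>i<e. x ^ p ^ i) = emb y"
    using range_emb by auto
  have "tr x = y" unfolding field_trace_def card_p by (rule the_equality) (auto simp: y)
  thus ?thesis by (simp add: y)
qed

lemma tr_add [simp]: "tr (x + y) = tr x + tr y"
proof -
  have "emb (tr (x + y)) = emb (tr x + tr y)" by (simp add: emb_tr frob_add sum.distrib)
  thus ?thesis by (simp del: emb_hom)
qed

lemma tr_scale [simp]: "tr (emb t * x) = t * tr x"
proof -
  have "emb (tr (emb t * x)) = emb (t * tr x)" by (simp add: emb_tr power_mult_distrib emb_power_card sum_distrib_left)
  thus ?thesis by (simp del: emb_hom)
qed

lemma tr_0 [simp]: "tr 0 = 0" using tr_scale[of 0 0] by simp

lemma tr_uminus [simp]: "tr (- x) = - tr x" using tr_scale[of "-1" x] by simp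

lemma tr_diff [simp]: "tr (x - y) = tr x - tr y" using tr_add[of x "- y"] by simp

lemma tr_frob [simp]: "tr (x ^ p ^ k) = tr x"
proof (induction k)
  case (Suc k)
  have "emb (tr (y ^ p)) = emb (tr y)" for y
  proof -
    have "(\<Sum>i<e. (y ^ p) ^ p ^ i) = (\<Sum>i<e. y ^ p ^ Suc i)"
      by (simp flip: power_mult)
    also have "\<dots> = (\<Sum>i<e. y ^ p ^ i)"
      using sum.lessThan_Suc_shift[of "\<lambda>i. y ^ p ^ i" e] frob_e[of y] by (simp add: mult.commute)
    finally show ?thesis by (simp add: emb_tr)
  qed
  from this[of "x ^ p ^ k"] have "tr ((x ^ p ^ k) ^ p) = tr (x ^ p ^ k)" by simp
  with Suc show ?case by (simp add: mult.commute flip: power_mult)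
qed simp

text \<open>The trace is given by a nonzero polynomial of degree at most \<open>p ^ (e - 1)\<close>,
  which cannot vanish at all \<open>p ^ e\<close> elements.\<close>

lemma exists_tr_nonzero: "\<exists>x. tr x \<noteq> 0"
proof (rule ccontr)
  assume "\<not> ?thesis"
  hence 0: "(\<Sum>i<e. x ^ p ^ i) = 0" for x :: 'q using emb_tr[of x] by simp
  define f where "f = (\<Sum>i<e. Polynomial.monom (1::'q) (p ^ i))"
  have "Polynomial.coeff f (p ^ (e - 1)) = (\<Sum>i<e. if i = e - 1 then 1 else 0)"
    unfolding f_def coeff_sum using p_gt_1 by (intro sum.cong) (auto simp: power_inject_exp)
  also have "\<dots> = 1" using e_pos by (simp add: sum.delta')
  finally have f0: "f \<noteq> 0" by auto
  have "degree f \<le> p ^ (e - 1)" unfolding f_def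
    by (intro degree_sum_le) (use p_gt_1 in \<open>auto intro!: order_trans[OF degree_monom_le] power_increasing\<close>)
  moreover have "card {x. poly f x = 0} = p ^ e"
    using 0 card_ext by (simp add: f_def poly_sum poly_monom)
  moreover have "p ^ (e - 1) < p ^ e" using p_gt_1 e_pos by (intro power_strict_increasing) auto
  ultimately show False using card_poly_roots_bound[OF f0] by simp
qed

lemma tr_nondegenerate:
  assumes "x \<noteq> 0"
  shows "\<exists>y. tr (x * y) \<noteq> 0"
proof -
  obtain y where "tr y \<noteq> 0" using exists_tr_nonzero by blast
  thus ?thesis using assms by (intro exI[of _ "y / x"]) simp
qed

text \<open>Moving in the direction \<open>u\<close> preserves \<open>S\<close> and changes
  \<open>f\<close> at the constant nonzero rate \<open>c\<close>, so translations carry any fibre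
  onto any other. It yields the equidistribution statements below, with \<open>S\<close> the whole
  field, the radical, a level of the form or an affine hyperplane.\<close>

lemma card_fibre_of_shift:
  fixes f :: "'q \<Rightarrow> 'p mod_ring"
  assumes S: "\<And>t y. y \<in> S \<Longrightarrow> y + emb t * u \<in> S"
    and f: "\<And>t y. y \<in> S \<Longrightarrow> f (y + emb t * u) = f y + t * c" and c: "c \<noteq> 0"
  shows "p * card {y \<in> S. f y = v} = card S"
proof -
  have eq: "card {y \<in> S. f y = w} = card {y \<in> S. f y = v}" for w
  proof (rule bij_betw_same_card)
    define t where "t = (v - w) / c"
    have tc: "t * c = v - w" using c by (simp add: t_def)
    show "bij_betw (\<lambda>y. y + emb t * u) {y \<in> S. f y = w} {y \<in> S. f y = v}"
    proof (rule bij_betwI)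
      show "(\<lambda>y. y + emb t * u) \<in> {y \<in> S. f y = w} \<rightarrow> {y \<in> S. f y = v}"
        using S f tc by auto
      show "(\<lambda>y. y + emb (- t) * u) \<in> {y \<in> S. f y = v} \<rightarrow> {y \<in> S. f y = w}"
      proof
        fix y assume y: "y \<in> {y \<in> S. f y = v}"
        have "f (y + emb (- t) * u) = w" using f[of y "- t"] y tc by simp
        thus "y + emb (- t) * u \<in> {y \<in> S. f y = w}" using S[of y "- t"] y by blast
      qed
    qed auto
  qed
  have "card S = card (\<Union>w\<in>UNIV. {y \<in> S. f y = w})" by (rule arg_cong[of _ _ card]) auto
  also have "\<dots> = (\<Sum>w\<in>UNIV. card {y \<in> S. f y = w})"
    by (rule card_UN_disjoint) auto
  also have "\<dots> = (\<Sum>w\<in>(UNIV :: 'p mod_ring set). card {y \<in> S. f y = v})"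
    by (rule sum.cong) (use eq in auto)
  also have "\<dots> = p * card {y \<in> S. f y = v}" by (simp add: card_p)
  finally show ?thesis by simp
qed

lemma card_tr_fibre:
  assumes "x \<noteq> 0"
  shows "p * card {y. tr (x * y) = v} = p ^ e"
proof -
  obtain u where u: "tr (x * u) \<noteq> 0" using tr_nondegenerate[OF assms] by blast
  have "p * card {y \<in> UNIV. tr (x * y) = v} = card (UNIV :: 'q set)"
  proof (rule card_fibre_of_shift[of _ u _ "tr (x * u)"])
    fix t y show "tr (x * (y + emb t * u)) = tr (x * y) + t * tr (x * u)"
      using tr_scale[of t "x * u"] by (simp add: algebra_simps)
  qed (use u in auto)
  thus ?thesis by (simp add: card_ext)
qed

end

section \<open>The quadratic form\<close>

text \<open>Here \<open>h\<close> is \<open>m / (2 * d)\<close> and \<open>r\<close> is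
  \<open>\<alpha> / d\<close>. Since \<open>e = 4 * d * h\<close>, coprimality of \<open>r\<close>
  and \<open>4 * h\<close> says that \<open>d\<close> is the gcd of \<open>\<alpha>\<close> and
  \<open>e\<close>; it also forces \<open>r\<close> to be odd.\<close>

locale gold_form = finite_field_extension p e prime_type ext_type
  for p e :: nat and prime_type :: "'p::prime_card itself" and ext_type :: "'q::{finite,field} itself" +
  fixes m \<alpha> d r h :: nat
  assumes odd_p: "odd p" and e_eq: "e = 2 * m" and m_eq: "m = 2 * d * h"
    and \<alpha>_eq: "\<alpha> = d * r" and coprime_r: "coprime r (4 * h)"
begin

sublocale odd_prime_field prime_type
  by unfold_locales (simp add: card_p odd_p)

text \<open>A natural number standing in for the exponent \<open>- \<alpha>\<close>: as
  \<open>\<alpha> + \<beta>\<close> is a multiple of \<open>e\<close>, the power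
  \<open>p ^ \<beta>\<close> inverts the power \<open>p ^ \<alpha>\<close>.\<close>

definition \<beta> :: nat where "\<beta> = (e - 1) * \<alpha>"

definition Q :: "'q \<Rightarrow> 'p mod_ring" where "Q x = tr (x ^ (p ^ \<alpha> + 1))"

definition L :: "'q \<Rightarrow> 'q" where "L x = x ^ p ^ \<alpha> + x ^ p ^ \<beta>"

definition R :: "'q set" where "R = {x. L x = 0}"

lemma \<alpha>\<beta>: "\<alpha> + \<beta> = e * \<alpha>"
  using e_pos unfolding \<beta>_def by (cases e) auto

lemma L_add: "L (x + y) = L x + L y" by (simp add: L_def frob_add)
lemma L_diff: "L (x - y) = L x - L y" by (simp add: L_def frob_diff)
lemma L_0 [simp]: "L 0 = 0" using p_pos by (simp add: L_def power_0_left)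
lemma L_scale: "L (emb t * x) = emb t * L x"
  by (simp add: L_def power_mult_distrib emb_power_card distrib_left)

lemma Q_0 [simp]: "Q 0 = 0" by (simp add: Q_def)

text \<open>Of the two cross terms, the one with the exponent on \<open>y\<close> is raised to the
  power \<open>p ^ \<beta>\<close>, which does not change its trace and moves the exponent onto
  \<open>x\<close>.\<close>

lemma Q_add: "Q (x + y) = Q x + Q y + tr (L x * y)"
proof -
  have "tr (y ^ p ^ \<alpha> * x) = tr ((y ^ p ^ \<alpha> * x) ^ p ^ \<beta>)" by simp
  also have "(y ^ p ^ \<alpha> * x) ^ p ^ \<beta> = x ^ p ^ \<beta> * y"
    by (simp add: power_mult_distrib frob_frob \<alpha>\<beta> frob_mult_e)
  finally have "tr (y ^ p ^ \<alpha> * x) = tr (x ^ p ^ \<beta> * y)" .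
  moreover have "(x + y) ^ (p ^ \<alpha> + 1) = x ^ (p ^ \<alpha> + 1) + y ^ (p ^ \<alpha> + 1) + x ^ p ^ \<alpha> * y + y ^ p ^ \<alpha> * x"
    by (simp add: frob_add power_add algebra_simps)
  ultimately show ?thesis by (simp add: Q_def L_def algebra_simps)
qed

lemma Q_scale: "Q (emb t * x) = t\<^sup>2 * Q x"
proof -
  have "(emb t * x) ^ (p ^ \<alpha> + 1) = emb (t\<^sup>2) * x ^ (p ^ \<alpha> + 1)"
    by (simp add: power_mult_distrib emb_power_card power2_eq_square)
  thus ?thesis by (simp only: Q_def tr_scale)
qed

text \<open>\<open>Q (x + x)\<close> is computed once by scaling and once by the polar form.\<close>

lemma tr_L_self: "tr (L x * x) = 2 * Q x"
proof -
  have "Q (emb (1 + 1) * x) = 4 * Q x" unfolding Q_scale by simp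
  hence "Q (x + x) = 4 * Q x" by (simp only: emb_hom distrib_right mult_1_left)
  hence "Q x + Q x + tr (L x * x) = 4 * Q x" by (simp only: Q_add)
  hence "tr (L x * x) = 4 * Q x - (Q x + Q x)" by (metis add_diff_cancel_left')
  thus ?thesis by (simp add: algebra_simps)
qed

lemma tr_L_commute: "tr (L x * y) = tr (L y * x)"
  using Q_add[of x y] Q_add[of y x] by (simp add: add.commute)

lemma Q_R: "x \<in> R \<Longrightarrow> Q x = 0"
  using tr_L_self[of x] two_neq_0 by (auto simp: R_def)

lemma Q_add_R: "x \<in> R \<Longrightarrow> Q (y + x) = Q y"
  using Q_add[of x y] Q_R[of x] by (auto simp: R_def add.commute)

section \<open>The radical of the form\<close>

lemma e_eq_d: "e = 4 * d * h" using m_eq e_eq by simp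
lemma d_pos: "d > 0" using e_eq_d e_pos by (cases d) auto
lemma h_pos: "h > 0" using e_eq_d e_pos by (cases h) auto

lemma odd_r: "odd r"
proof
  assume "even r"
  hence "2 dvd gcd r (4 * h)" by (intro gcd_greatest) auto
  thus False using coprime_r unfolding coprime_iff_gcd_eq_1 by simp
qed

lemma frob_mult_of_neg:
  assumes "(y::'q) ^ p ^ i = - y"
  shows "y ^ p ^ (i * k) = (-1) ^ k * y"
proof (induction k)
  case (Suc k)
  have "y ^ p ^ (i * Suc k) = (y ^ p ^ (i * k)) ^ p ^ i" by (simp add: frob_frob add.commute)
  also have "\<dots> = (-1) ^ k * - y"
    using assms odd_p by (cases "even k") (simp_all add: Suc frob_uminus)
  finally show ?case by simp
qed simp

text \<open>Raising \<open>L y = 0\<close> to the power \<open>p ^ \<alpha>\<close> gives the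
  condition with \<open>2 * \<alpha>\<close> in place of \<open>2 * d\<close>. The two conditions
  agree because \<open>\<alpha> = d * r\<close> with \<open>r\<close> odd and invertible modulo
  \<open>2 * h\<close>, while \<open>e = 2 * d * (2 * h)\<close>.\<close>

lemma R_iff: "y \<in> R \<longleftrightarrow> y ^ p ^ (2 * d) = - y"
proof -
  have 1: "y ^ p ^ (2 * \<alpha>) = - y" if "y \<in> R"
  proof -
    have "y ^ p ^ \<alpha> = - (y ^ p ^ \<beta>)" using that by (simp add: R_def L_def add_eq_0_iff2)
    hence "(y ^ p ^ \<alpha>) ^ p ^ \<alpha> = (- (y ^ p ^ \<beta>)) ^ p ^ \<alpha>" by simp
    thus ?thesis by (simp only: frob_uminus frob_frob add.commute[of \<beta>] \<alpha>\<beta> frob_mult_e mult_2)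
  qed
  have 2: "y \<in> R" if "y ^ p ^ (2 * \<alpha>) = - y"
  proof -
    have "(y ^ p ^ (2 * \<alpha>)) ^ p ^ \<beta> = - (y ^ p ^ \<beta>)" by (simp only: that frob_uminus)
    moreover have "(y ^ p ^ (2 * \<alpha>)) ^ p ^ \<beta> = (y ^ p ^ (\<alpha> + \<beta>)) ^ p ^ \<alpha>"
      by (simp only: frob_frob) (simp add: add_ac mult_2)
    ultimately show ?thesis by (simp add: \<alpha>\<beta> frob_mult_e R_def L_def)
  qed
  have 3: "y ^ p ^ (2 * \<alpha>) = - y" if "y ^ p ^ (2 * d) = - y"
    using frob_mult_of_neg[OF that, of r] odd_r by (simp add: \<alpha>_eq mult_ac)
  have 4: "y ^ p ^ (2 * d) = - y" if y: "y ^ p ^ (2 * \<alpha>) = - y"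
  proof -
    have "coprime r (2 * h)" using coprime_r odd_r by simp
    \<comment> \<open>For this inverse \<open>k\<close> of \<open>r\<close>, the exponent
      \<open>2 * \<alpha> * k\<close> is \<open>2 * d\<close> modulo \<open>e\<close>. As
      \<open>k\<close> is odd, iterating \<open>k\<close> times keeps the minus sign.\<close>
    then obtain k where k: "[r * k = 1] (mod 2 * h)"
      using cong_solve_coprime_nat[of r "2 * h"] unfolding One_nat_def by blast
    have k0: "k > 0" 
    proof (rule ccontr)
      assume "\<not> k > 0"
      hence "[1 = 0] (mod 2 * h)" using k by (simp add: cong_sym_eq)
      hence "2 * h dvd 1" by (simp only: cong_0_iff)
      thus False by simp
    qed
    have "r > 0" using odd_r by (cases r) auto
    hence "r * k \<ge> 1" using k0 by simp
    then obtain l where "r * k = l * (2 * h) + 1"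
      using k cong_le_nat by blast
    hence l: "r * k = 1 + 2 * h * l" by simp
    have "odd (r * k)" unfolding l by simp
    hence "odd k" by simp
    have "2 * \<alpha> * k = 2 * d * (r * k)" by (simp add: \<alpha>_eq mult_ac)
    also have "\<dots> = e * l + 2 * d" unfolding l by (simp add: e_eq_d algebra_simps)
    finally have "y ^ p ^ (2 * \<alpha> * k) = (y ^ p ^ (e * l)) ^ p ^ (2 * d)" by (simp only: frob_frob)
    also have "\<dots> = y ^ p ^ (2 * d)" by (simp only: frob_mult_e)
    finally show ?thesis using frob_mult_of_neg[OF y, of k] \<open>odd k\<close> by simp
  qed
  show ?thesis using 1 2 3 4 by blast
qed

text \<open>The quotient of \<open>p ^ e - 1\<close> by \<open>p ^ (4 * d) - 1\<close>, as a
  geometric sum.\<close>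

definition M :: nat where "M = (\<Sum>i<h. (p ^ (4 * d)) ^ i)"

lemma card_minus_1: "CARD('q) - 1 = (p ^ (2 * d) - 1) * ((p ^ (2 * d) + 1) * M)"
proof -
  have "int (p ^ e - 1) = int (p ^ (4 * d)) ^ h - 1"
    using p_pos by (simp add: of_nat_diff e_eq_d power_mult)
  also have "\<dots> = (int (p ^ (4 * d)) - 1) * int M"
    unfolding M_def by (subst power_diff_1_eq) simp
  also have "int (p ^ (4 * d)) = int (p ^ (2 * d)) * int (p ^ (2 * d))"
    by (simp flip: power_add)
  also have "(int (p ^ (2 * d)) * int (p ^ (2 * d)) - 1) * int M = 
     int ((p ^ (2 * d) - 1) * ((p ^ (2 * d) + 1) * M))"
    using p_pos by (simp add: of_nat_diff algebra_simps)
  finally show ?thesis using card_ext by linarith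
qed

lemma card_minus_1': "CARD('q) - 1 = (p ^ d + 1) * ((p ^ d - 1) * ((p ^ (2 * d) + 1) * M))"
proof -
  have "p ^ (2 * d) - 1 = (p ^ d + 1) * (p ^ d - 1)"
    by (simp add: power_add algebra_simps diff_mult_distrib2 mult_2[of d, unfolded mult.commute[of 2]])
  thus ?thesis unfolding card_minus_1 by (simp only: mult_ac)
qed

lemma card_R: "card R = p ^ (2 * d)"
proof -
  have gt: "p ^ (2 * d) > 1" using p_gt_1 d_pos by (intro one_less_power) auto
  \<comment> \<open>The root count needs -1 raised to \<open>(p ^ (2 * d) + 1) * M\<close> to be 1;
    this exponent is even because \<open>p\<close> is odd.\<close>
  have "card {x::'q. x ^ (p ^ (2 * d) - 1) = -1} = p ^ (2 * d) - 1"
    by (rule card_nth_roots_finite_field[OF card_minus_1[symmetric]]) (use odd_p in simp)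
  moreover have "R = insert 0 {x. x ^ (p ^ (2 * d) - 1) = -1}"
  proof -
    have "x ^ p ^ (2 * d) = x * x ^ (p ^ (2 * d) - 1)" for x :: 'q
      using gt by (metis power_eq_if not_less0)
    hence "x ^ p ^ (2 * d) = - x \<longleftrightarrow> x * (x ^ (p ^ (2 * d) - 1) + 1) = 0" for x :: 'q
      by (simp only: eq_neg_iff_add_eq_0 distrib_left mult_1_right)
    hence "x \<in> R \<longleftrightarrow> x = 0 \<or> x ^ (p ^ (2 * d) - 1) = -1" for x
      by (simp only: R_iff mult_eq_0_iff eq_neg_iff_add_eq_0)
    thus ?thesis by blast
  qed
  moreover have "0 \<notin> {x::'q. x ^ (p ^ (2 * d) - 1) = -1}"
    using gt by (auto simp: power_0_left)
  ultimately show ?thesis using gt by (simp add: card_insert_if)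
qed

section \<open>Level sizes of the form\<close>

lemma Q_norm_scale:
  assumes l: "\<kappa> ^ (p ^ d + 1) = emb v" and v: "v \<noteq> 0"
  shows "Q (\<kappa> * x) = v * Q x"
proof -
  have l0: "\<kappa> \<noteq> 0" using l v by auto
  have "v * v ^ (p ^ d - 1) = v" using mod_ring_power_card[of v d] p_pos by (simp flip: power_Suc)
  hence v1: "v ^ (p ^ d - 1) = 1" using v by simp
  have "(\<kappa> ^ (p ^ d + 1)) ^ (p ^ d - 1) = 1" unfolding l using v1 by (metis emb_power emb_hom(2))
  hence "\<kappa> * (\<kappa> ^ ((p ^ d + 1) * (p ^ d - 1))) = \<kappa>" by (simp only: power_mult mult_1_right)
  moreover have "Suc ((p ^ d + 1) * (p ^ d - 1)) = p ^ (2 * d)"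
    using p_pos by (simp add: power_add algebra_simps diff_mult_distrib2 mult_2[of d, unfolded mult.commute[of 2]])
  ultimately have l2: "\<kappa> ^ p ^ (2 * d) = \<kappa>" by (metis power_Suc)
  \<comment> \<open>By \<open>l2\<close>, \<open>\<kappa>\<close> lies in the subfield with
    \<open>p ^ (2 * d)\<close> elements. As \<open>\<alpha>\<close> is an odd multiple of
    \<open>d\<close>, the powers \<open>p ^ \<alpha>\<close> and \<open>p ^ d\<close> act alike on
    it, so the norm equation also holds with \<open>p ^ \<alpha>\<close>.\<close>
  have l3: "\<kappa> ^ p ^ (2 * d * k) = \<kappa>" for k
    by (induction k) (simp_all add: l2 flip: frob_frob)
  obtain s where s: "r = 2 * s + 1" using odd_r oddE by blast
  have "\<kappa> ^ p ^ \<alpha> = (\<kappa> ^ p ^ (2 * d * s)) ^ p ^ d"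
    by (simp only: frob_frob \<alpha>_eq s) (simp add: algebra_simps)
  hence "\<kappa> ^ (p ^ \<alpha> + 1) = emb v" using l l3[of s] by simp
  thus ?thesis unfolding Q_def by (simp only: power_mult_distrib tr_scale)
qed

definition N :: "'p mod_ring \<Rightarrow> nat" where "N v = card {x. Q x = v}"

text \<open>A nonzero \<open>v\<close> satisfies \<open>v ^ (p ^ d - 1) = 1\<close>. Since
  \<open>p ^ d + 1\<close> divides \<open>CARD('q) - 1\<close> with a cofactor that is a multiple of
  \<open>p ^ d - 1\<close>, the root count applies.\<close>

lemma exists_norm:
  assumes "v \<noteq> 0"
  shows "\<exists>\<kappa>. \<kappa> ^ (p ^ d + 1) = emb v"
proof -
  have "v * v ^ (p ^ d - 1) = v" using mod_ring_power_card[of v d] p_pos by (simp flip: power_Suc)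
  hence "v ^ (p ^ d - 1) = 1" using assms by simp
  hence "emb v ^ (p ^ d - 1) = 1" by (metis emb_power emb_hom(2))
  hence "emb v ^ ((p ^ d - 1) * ((p ^ (2 * d) + 1) * M)) = 1" by (simp add: power_mult)
  hence "card {x. x ^ (p ^ d + 1) = emb v} = p ^ d + 1"
    by (intro card_nth_roots_finite_field[OF card_minus_1'[symmetric]])
  thus ?thesis by (metis (mono_tags, lifting) Collect_empty_eq add_is_0 card.empty one_neq_zero)
qed

lemma N_nonzero:
  assumes "v \<noteq> 0"
  shows "N v = N 1"
proof -
  obtain \<kappa> where l: "\<kappa> ^ (p ^ d + 1) = emb v" using exists_norm[OF assms] by blast
  have l0: "\<kappa> \<noteq> 0" using l assms by auto
  have "bij_betw ((*) \<kappa>) {x. Q x = 1} {x. Q x = v}"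
  proof (rule bij_betwI[of _ _ _ "\<lambda>x. x / \<kappa>"])
    show "(\<lambda>x. x / \<kappa>) \<in> {x. Q x = v} \<rightarrow> {x. Q x = 1}"
    proof
      fix x assume "x \<in> {x. Q x = v}"
      hence "v * Q (x / \<kappa>) = v * 1" using Q_norm_scale[OF l assms, of "x / \<kappa>"] l0 by simp
      thus "x / \<kappa> \<in> {x. Q x = 1}" using assms by simp
    qed
    show "(*) \<kappa> \<in> {x. Q x = 1} \<rightarrow> {x. Q x = v}" by (simp add: Q_norm_scale[OF l assms])
  qed (use l0 in auto)
  thus ?thesis unfolding N_def by (metis bij_betw_same_card)
qed

lemma sum_fibres_Q: "(\<Sum>v\<in>UNIV. N v) = p ^ e"
proof -
  have "(\<Sum>v\<in>UNIV. N v) = card (\<Union>v\<in>UNIV. {x. Q x = v})"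
    unfolding N_def by (rule card_UN_disjoint[symmetric]) auto
  also have "(\<Union>v\<in>UNIV. {x. Q x = v}) = UNIV" by auto
  finally show ?thesis using card_ext by simp
qed

lemma sum_mod_ring: 
  fixes f :: "'p mod_ring \<Rightarrow> 'c::comm_semiring_1"
  assumes "\<And>v. v \<noteq> 0 \<Longrightarrow> f v = c"
  shows "(\<Sum>v\<in>UNIV. f v) = f 0 + of_nat (p - 1) * c"
proof -
  have "(\<Sum>v\<in>UNIV. f v) = f 0 + (\<Sum>v\<in>UNIV - {0}. f v)" by (rule sum.remove) auto
  also have "(\<Sum>v\<in>UNIV - {0}. f v) = (\<Sum>v\<in>UNIV - {0::'p mod_ring}. c)"
    by (rule sum.cong) (use assms in auto)
  finally show ?thesis by (simp add: card_Diff_singleton card_p)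
qed

lemma N_sum: "N 0 + (p - 1) * N 1 = p ^ e"
  using sum_mod_ring[of N "N 1", OF N_nonzero] sum_fibres_Q by simp

text \<open>The sets counted are invariant under the \<open>p ^ d + 1\<close> solutions of \<open>\<mu> ^ (p ^ d + 1) = 1\<close>.\<close>

lemma norm_dvd_card: "(p ^ d + 1) dvd card {x. x \<noteq> 0 \<and> Q x = v}" (is "?n dvd card ?S")
proof -
  define F where "F y = {x::'q. x ^ ?n = y}" for y
  have F: "F (x ^ ?n) \<subseteq> ?S" "card (F (x ^ ?n)) = ?n" if "x \<in> ?S" for x
  proof -
    show "F (x ^ ?n) \<subseteq> ?S"
    proof
      fix y assume "y \<in> F (x ^ ?n)"
      hence y: "y ^ ?n = x ^ ?n" by (simp add: F_def)
      have x: "x \<noteq> 0" "Q x = v" using that by auto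
      have "(y / x) ^ ?n = emb 1" using y x by (simp add: power_divide)
      from Q_norm_scale[OF this, of x] x have "Q y = v" by simp
      moreover have "y \<noteq> 0" using y x by (auto simp: power_0_left)
      ultimately show "y \<in> ?S" by simp
    qed
    have "x ^ (CARD('q) - 1) = 1" using that by (intro finite_field_power_card_minus_1) simp
    hence "(x ^ ?n) ^ ((p ^ d - 1) * ((p ^ (2 * d) + 1) * M)) = 1"
      by (simp only: card_minus_1' power_mult)
    thus "card (F (x ^ ?n)) = ?n"
      unfolding F_def by (intro card_nth_roots_finite_field[OF card_minus_1'[symmetric]])
  qed
  \<comment> \<open>The set is a disjoint union of fibres of \<open>x ^ (p ^ d + 1)\<close>, each
    with exactly \<open>p ^ d + 1\<close> elements.\<close>
  have "?S = (\<Union>y\<in>(\<lambda>x. x ^ ?n) ` ?S. F y)"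
  proof
    show "?S \<subseteq> (\<Union>y\<in>(\<lambda>x. x ^ ?n) ` ?S. F y)" by (auto simp: F_def)
    show "(\<Union>y\<in>(\<lambda>x. x ^ ?n) ` ?S. F y) \<subseteq> ?S" using F(1) by blast
  qed
  hence "card ?S = card (\<Union>y\<in>(\<lambda>x. x ^ ?n) ` ?S. F y)" by simp
  also have "\<dots> = (\<Sum>y\<in>(\<lambda>x. x ^ ?n) ` ?S. card (F y))"
    by (rule card_UN_disjoint) (auto simp: F_def)
  also have "\<dots> = (\<Sum>y\<in>(\<lambda>x. x ^ ?n) ` ?S. ?n)"
    by (rule sum.cong) (use F(2) in auto)
  finally show ?thesis by (simp only: sum_constant dvd_triv_right)
qed

lemma card_tr_fibre':
  assumes "x \<noteq> 0"
  shows "card {y. tr (x * y) = v} = p ^ (e - 1)"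
proof -
  have "p * card {y. tr (x * y) = v} = p * p ^ (e - 1)"
    using card_tr_fibre[OF assms, of v] e_pos by (simp flip: power_Suc)
  thus ?thesis using p_pos by simp
qed

text \<open>Both sides count the pairs \<open>(x, y)\<close> with \<open>Q x = Q y\<close>, the right one by \<open>x - y\<close>.\<close>

lemma N_square_sum:
  "N 0 ^ 2 + (p - 1) * N 1 ^ 2 = p ^ (2 * d) * p ^ e + (p ^ e - p ^ (2 * d)) * p ^ (e - 1)"
proof -
  let ?P = "{(x, y). Q x = Q y}"
  have "?P = (\<Union>v\<in>UNIV. {x. Q x = v} \<times> {x. Q x = v})" by auto
  hence "card ?P = (\<Sum>v\<in>UNIV. card ({x. Q x = v} \<times> {x. Q x = v}))"
    by (simp only:) (rule card_UN_disjoint, auto)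
  also have "\<dots> = (\<Sum>v\<in>UNIV. N v ^ 2)" by (simp only: N_def card_cartesian_product power2_eq_square)
  also have "\<dots> = N 0 ^ 2 + (p - 1) * N 1 ^ 2"
    using sum_mod_ring[of "\<lambda>v. N v ^ 2" "N 1 ^ 2", OF arg_cong[OF N_nonzero]] by simp
  finally have 1: "card ?P = N 0 ^ 2 + (p - 1) * N 1 ^ 2" .
  have "bij_betw (\<lambda>(u, y). (u + y, y)) (SIGMA u:UNIV. {y. tr (L u * y) = - Q u}) ?P"
  proof (rule bij_betwI[of _ _ _ "\<lambda>(x, y). (x - y, y)"])
    show "(\<lambda>(u, y). (u + y, y)) \<in> (SIGMA u:UNIV. {y. tr (L u * y) = - Q u}) \<rightarrow> ?P"
      by (auto simp: Q_add)
    show "(\<lambda>(x, y). (x - y, y)) \<in> ?P \<rightarrow> (SIGMA u:UNIV. {y. tr (L u * y) = - Q u})"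
    proof
      fix z assume "z \<in> ?P"
      then obtain x y where z: "z = (x, y)" "Q x = Q y" by auto
      have "Q (x - y) + tr (L (x - y) * y) = 0" using Q_add[of "x - y" y] z by simp
      hence "tr (L (x - y) * y) = - Q (x - y)" by (rule minus_unique[symmetric])
      thus "(case z of (x, y) \<Rightarrow> (x - y, y)) \<in> (SIGMA u:UNIV. {y. tr (L u * y) = - Q u})"
        using z by simp
    qed
  qed auto
  from bij_betw_same_card[OF this, symmetric]
  have "card ?P = card (SIGMA u:UNIV. {y. tr (L u * y) = - Q u})" .
  also have "\<dots> = (\<Sum>u\<in>UNIV. card {y. tr (L u * y) = - Q u})" by simp
  \<comment> \<open>For \<open>u\<close> in the radical the condition on \<open>y\<close> always
    holds; for any other \<open>u\<close> it cuts out an affine hyperplane.\<close>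
  also have "\<dots> = (\<Sum>u\<in>R. card {y. tr (L u * y) = - Q u}) + (\<Sum>u\<in>UNIV - R. card {y. tr (L u * y) = - Q u})"
    by (subst add.commute, rule sum.subset_diff) auto
  also have "(\<Sum>u\<in>R. card {y. tr (L u * y) = - Q u}) = (\<Sum>u\<in>R. p ^ e)"
    by (rule sum.cong) (auto simp: Q_R R_def card_ext)
  also have "(\<Sum>u\<in>UNIV - R. card {y. tr (L u * y) = - Q u}) = (\<Sum>u\<in>UNIV - R. p ^ (e - 1))"
    by (rule sum.cong) (auto simp: R_def card_tr_fibre')
  finally show ?thesis using 1 by (simp add: card_R card_Diff_subset card_ext)
qed

text \<open>The total and the sum of squares of the level sizes determine the square of the
  difference. For the sign: the difference is 1 modulo \<open>p ^ d + 1\<close>, whereas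
  \<open>p ^ (m + d)\<close>, being the power of \<open>p ^ d\<close> with odd exponent
  \<open>2 * h + 1\<close>, is -1 there.\<close>

lemma N_diff: "int (N 0) - int (N 1) = - int (p ^ (m + d))"
proof -
  define S where "S = int (N 0) - int (N 1)"
  define P where "P = int p"
  have P: "int (p - 1) = P - 1" using p_pos by (simp add: P_def of_nat_diff)
  have E: "e = Suc (e - 1)" using e_pos by simp
  have N0: "int (N 0) = S + int (N 1)" by (simp add: S_def)
  have "int (N 0 + (p - 1) * N 1) = int (p ^ e)" by (simp only: N_sum)
  hence a: "P * int (N 1) + S = P ^ e" unfolding of_nat_add of_nat_mult P N0 by (simp add: algebra_simps P_def)
  have le: "p ^ (2 * d) \<le> p ^ e" using p_gt_1 e_eq_d h_pos by (intro power_increasing) auto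
  have "int (N 0 ^ 2 + (p - 1) * N 1 ^ 2) = int (p ^ (2 * d) * p ^ e + (p ^ e - p ^ (2 * d)) * p ^ (e - 1))"
    by (simp only: N_square_sum)
  hence "(S + int (N 1))^2 + (P - 1) * int (N 1)^2 = P ^ (2 * d) * P ^ e + (P ^ e - P ^ (2 * d)) * P ^ (e - 1)"
    unfolding of_nat_add of_nat_mult of_nat_power P N0 of_nat_diff[OF le] by (simp add: P_def)
  \<comment> \<open>After multiplication by \<open>P\<close> the left side becomes
    \<open>(P * N 1 + S) ^ 2 + (P - 1) * S ^ 2\<close>, into which the known total is
    substituted.\<close>
  hence "P * ((S + int (N 1))^2 + (P - 1) * int (N 1)^2) = P * (P ^ (2 * d) * P ^ e + (P ^ e - P ^ (2 * d)) * P ^ (e - 1))"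
    by (simp only:)
  also have "\<dots> = P * (P ^ (2 * d) * P ^ e) + (P ^ e - P ^ (2 * d)) * (P * P ^ (e - 1))"
    by (simp only: distrib_left mult.left_commute[of P])
  also have "P * P ^ (e - 1) = P ^ e" using E by (metis power_Suc)
  also have "P * ((S + int (N 1))^2 + (P - 1) * int (N 1)^2) = (P * int (N 1) + S)^2 + (P - 1) * S^2"
    by (simp add: power2_eq_square algebra_simps)
  finally have "(P - 1) * S^2 = (P - 1) * (P ^ (2 * d) * P ^ e)"
    unfolding a by (simp add: power2_eq_square algebra_simps)
  moreover have "P - 1 \<noteq> 0" using p_gt_1 by (simp add: P_def)
  ultimately have "S^2 = P ^ (2 * d) * P ^ e" by simp
  also have "\<dots> = (P ^ (m + d))^2"
    unfolding e_eq power2_eq_square power_add[symmetric] by (rule arg_cong[of _ _ "\<lambda>i. P ^ i"]) simp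
  finally have S: "S = P ^ (m + d) \<or> S = - (P ^ (m + d))" by (simp add: power2_eq_iff)
  have "(int p ^ d + 1) dvd int (N 1)"
  proof -
    have "{x. x \<noteq> 0 \<and> Q x = 1} = {x. Q x = 1}" by auto
    hence "(p ^ d + 1) dvd N 1" using norm_dvd_card[of 1] by (simp add: N_def)
    hence "int (p ^ d + 1) dvd int (N 1)" by (simp only: of_nat_dvd_iff)
    thus ?thesis by (simp add: add.commute)
  qed
  moreover have "(int p ^ d + 1) dvd int (N 0) - 1"
  proof -
    \<comment> \<open>The divisibility concerns nonzero elements only; the zero level contains 0 as
      well, hence the shift by 1.\<close>
    have "{x. Q x = 0} = insert 0 {x. x \<noteq> 0 \<and> Q x = 0}" by auto
    hence "N 0 = Suc (card {x. x \<noteq> 0 \<and> Q x = 0})" by (simp add: N_def)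
    hence "int (N 0) - 1 = int (card {x. x \<noteq> 0 \<and> Q x = 0})" by simp
    moreover have "int (p ^ d + 1) dvd int (card {x. x \<noteq> 0 \<and> Q x = 0})"
      using norm_dvd_card[of 0] by (simp only: of_nat_dvd_iff)
    ultimately show ?thesis by (simp add: add.commute)
  qed
  ultimately have "(P ^ d + 1) dvd (int (N 0) - 1) - int (N 1)" unfolding P_def by (rule dvd_diff[rotated])
  hence d1: "(P ^ d + 1) dvd S - 1" by (simp add: S_def algebra_simps)
  have d2: "(P ^ d + 1) dvd P ^ (m + d) + 1"
  proof -
    have "[P ^ d = -1] (mod P ^ d + 1)" by (simp add: cong_iff_dvd_diff)
    hence "[(P ^ d) ^ (2 * h + 1) = (-1) ^ (2 * h + 1)] (mod P ^ d + 1)" by (rule cong_pow)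
    moreover have "(-1 :: int) ^ (2 * h + 1) = -1" by simp
    moreover have "(P ^ d) ^ (2 * h + 1) = P ^ (m + d)"
      unfolding power_mult[symmetric] m_eq by (rule arg_cong[of _ _ "\<lambda>i. P ^ i"]) simp
    ultimately show ?thesis by (simp only: cong_iff_dvd_diff diff_minus_eq_add)
  qed
  have "S \<noteq> P ^ (m + d)"
  proof
    assume "S = P ^ (m + d)"
    hence "(P ^ d + 1) dvd (P ^ (m + d) + 1) - (P ^ (m + d) - 1)" using d1 d2 dvd_diff by blast
    hence "(P ^ d + 1) dvd 2" by simp
    hence "P ^ d + 1 \<le> 2" by (rule zdvd_imp_le) simp
    moreover have "P ^ d > 1" using p_gt_1 d_pos by (intro one_less_power) (auto simp: P_def)
    ultimately show False by simp
  qed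
  thus ?thesis using S by (simp add: S_def P_def)
qed

text \<open>\<open>p * K\<close> is the excess of a nonzero level of \<open>Q\<close> over the zero
  level.\<close>

definition K :: nat where "K = p ^ (m + d - 1)"

lemma m_pos: "m > 0" using e_eq e_pos by simp

lemma pK: "p * K = p ^ (m + d)"
  using m_pos unfolding K_def by (simp flip: power_Suc)

lemma N_1: "N 1 = p ^ (e - 1) + K"
proof -
  have "int (p - 1) = int p - 1" using p_pos by (simp add: of_nat_diff)
  hence "int (N 0) + (int p - 1) * int (N 1) = int (p ^ e)"
    using arg_cong[OF N_sum, of int] by (simp only: of_nat_add of_nat_mult)
  hence "int p * int (N 1) = int (p ^ e) - (int (N 0) - int (N 1))" by (simp add: algebra_simps)
  also have "\<dots> = int (p ^ e) + int (p * K)" unfolding N_diff pK by simp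
  also have "p ^ e = p * p ^ (e - 1)" using e_pos by (simp flip: power_Suc)
  finally have "int p * int (N 1) = int p * int (p ^ (e - 1) + K)" by (simp add: algebra_simps)
  thus ?thesis using p_pos by (metis mult_cancel_left of_nat_0_eq_iff of_nat_eq_iff less_irrefl)
qed

lemma N_neq_0: "v \<noteq> 0 \<Longrightarrow> N v = p ^ (e - 1) + K"
  by (simp only: N_nonzero[of v] N_1 not_False_eq_True)

lemma N_0: "int (N 0) = int (p ^ (e - 1)) - (int p - 1) * int K"
  using N_diff N_1 pK by (simp add: algebra_simps flip: of_nat_mult)

section \<open>The image of the polar map\<close>

lemma card_L_image:
  assumes "\<And>x y. y \<in> R \<Longrightarrow> x \<in> X \<Longrightarrow> x + y \<in> X"
  shows "card (L ` X) * p ^ (2 * d) = card X"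
proof -
  have "card X = card (\<Union>w\<in>L ` X. {x \<in> X. L x = w})" by (rule arg_cong[of _ _ card]) auto
  also have "\<dots> = (\<Sum>w\<in>L ` X. card {x \<in> X. L x = w})" by (rule card_UN_disjoint) auto
  also have "\<dots> = (\<Sum>w\<in>L ` X. p ^ (2 * d))"
  proof (rule sum.cong)
    fix w assume "w \<in> L ` X"
    then obtain z where z: "z \<in> X" "w = L z" by auto
    \<comment> \<open>The fibres of \<open>L\<close> inside \<open>X\<close> are full cosets of
      \<open>R\<close>, because \<open>X\<close> is stable under adding elements of
      \<open>R\<close>.\<close>
    have "bij_betw ((+) z) R {x \<in> X. L x = w}"
      by (rule bij_betwI[of _ _ _ "\<lambda>x. x - z"]) (use z assms in \<open>auto simp: L_add L_diff R_def\<close>)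
    thus "card {x \<in> X. L x = w} = p ^ (2 * d)" using card_R by (metis bij_betw_same_card)
  qed simp
  finally show ?thesis by simp
qed

text \<open>By symmetry of the polar form, \<open>range L\<close> is contained in the annihilator
  \<open>A\<close> of \<open>R\<close>. A double count gives \<open>card A * card R = p ^ e\<close>,
  and the cosets of \<open>R\<close> give the same equation for \<open>range L\<close>, so the two
  sets coincide.\<close>

lemma tr_nonzero_on_R:
  assumes "x \<notin> range L"
  shows "\<exists>y\<in>R. tr (x * y) \<noteq> 0"
proof -
  define A where "A = {x. \<forall>y\<in>R. tr (x * y) = 0}"
  have sub: "range L \<subseteq> A"
    by (auto simp: A_def R_def) (metis R_def mem_Collect_eq mult_zero_left tr_0 tr_L_commute)
  have f1: "p * card {x. tr (x * y) = 0} = (if y = 0 then p * p ^ e else p ^ e)" for y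
    using card_tr_fibre[of y 0] by (auto simp: mult.commute card_ext)
  have f2: "p * card {y \<in> R. tr (x * y) = 0} = (if x \<in> A then p * card R else card R)" for x
  proof (cases "x \<in> A")
    case True
    hence "{y \<in> R. tr (x * y) = 0} = R" by (auto simp: A_def)
    thus ?thesis using True by simp
  next
    case False
    then obtain u where u: "u \<in> R" "tr (x * u) \<noteq> 0" by (auto simp: A_def)
    have "p * card {y \<in> R. tr (x * y) = 0} = card R"
    proof (rule card_fibre_of_shift[of _ u _ "tr (x * u)"])
      fix t y assume "y \<in> R"
      thus "y + emb t * u \<in> R" using u by (simp add: R_def L_add L_scale)
      show "tr (x * (y + emb t * u)) = tr (x * y) + t * tr (x * u)"
        using tr_scale[of t "x * u"] by (simp add: algebra_simps)
    qed (use u in auto)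
    thus ?thesis using False by simp
  qed
  \<comment> \<open>The pairs with \<open>y\<close> in \<open>R\<close> and
    \<open>tr (x * y) = 0\<close> are counted by either coordinate; \<open>f1\<close> and
    \<open>f2\<close> carry a factor \<open>p\<close> to avoid division.\<close>
  have "(\<Sum>y\<in>R. card {x. tr (x * y) = 0}) = card (SIGMA y:R. {x. tr (x * y) = 0})" by simp
  also have "\<dots> = card (SIGMA x:UNIV. {y \<in> R. tr (x * y) = 0})"
    by (rule bij_betw_same_card[of prod.swap]) (auto simp: bij_betw_def inj_on_def image_iff)
  also have "\<dots> = (\<Sum>x\<in>UNIV. card {y \<in> R. tr (x * y) = 0})" by simp
  finally have "(\<Sum>y\<in>R. p * card {x. tr (x * y) = 0}) = (\<Sum>x\<in>UNIV. p * card {y \<in> R. tr (x * y) = 0})"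
    by (simp flip: sum_distrib_left)
  hence "(\<Sum>y\<in>R. if y = 0 then p * p ^ e else p ^ e) = (\<Sum>x\<in>UNIV. if x \<in> A then p * card R else card R)"
    by (simp only: f1 f2)
  also have "\<dots> = card A * (p * card R) + (p ^ e - card A) * card R"
    by (simp add: sum.If_cases Compl_eq_Diff_UNIV card_Diff_subset card_ext)
  also have "(\<Sum>y\<in>R. if y = 0 then p * p ^ e else p ^ e) = p * p ^ e + (card R - 1) * p ^ e"
  proof -
    have "0 \<in> R" by (simp add: R_def)
    hence "(\<Sum>y\<in>R. if y = 0 then p * p ^ e else p ^ e) = p * p ^ e + (\<Sum>y\<in>R - {0}. if y = 0 then p * p ^ e else p ^ e)"
      by (subst sum.remove[of _ 0]) auto
    also have "(\<Sum>y\<in>R - {0}. if y = 0 then p * p ^ e else p ^ e) = (\<Sum>y\<in>R - {0}. p ^ e)"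
      by (rule sum.cong) auto
    finally show ?thesis using \<open>0 \<in> R\<close> by (simp add: card_Diff_singleton)
  qed
  finally have eq: "p * p ^ e + (card R - 1) * p ^ e = card A * (p * card R) + (p ^ e - card A) * card R" .
  have cA: "card A \<le> p ^ e" using card_mono[of UNIV A] card_ext by simp
  have cR: "card R \<ge> 1" using card_R p_pos by simp
  have "int p * int (p ^ e) + (int (card R) - 1) * int (p ^ e) =
     int (card A) * (int p * int (card R)) + (int (p ^ e) - int (card A)) * int (card R)"
    using arg_cong[OF eq, of int] cA cR by (simp only: of_nat_add of_nat_mult of_nat_diff of_nat_1)
  hence "(int p - 1) * int (p ^ e) = (int p - 1) * (int (card A) * int (card R))"
    by (simp add: algebra_simps)
  moreover have "int p - 1 \<noteq> 0" using p_gt_1 by simp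
  ultimately have "int (p ^ e) = int (card A * card R)" by (simp only: mult_cancel_left of_nat_mult) simp
  hence "p ^ e = card A * card R" by (simp only: of_nat_eq_iff)
  hence "card A * p ^ (2 * d) = p ^ e" by (simp only: card_R)
  moreover have "card (range L) * p ^ (2 * d) = p ^ e" using card_L_image[of UNIV] card_ext by simp
  ultimately have "card A = card (range L)" using p_pos
    by (metis mult_cancel2 power_not_zero not_gr_zero)
  hence "range L = A" using sub by (intro card_subset_eq) auto
  thus ?thesis using assms by (auto simp: A_def)
qed

section \<open>Levels of the form on a hyperplane\<close>

lemma quarter_square:
  fixes s v :: "'p mod_ring"
  assumes v: "v \<noteq> 0"
  shows "s\<^sup>2 / (4 * v) = (s / (2 * v))\<^sup>2 * v"
proof -
  define t where "t = s / (2 * v)"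
  have "s = t * (2 * v)" using v two_neq_0 by (simp add: t_def)
  hence "s\<^sup>2 = (t\<^sup>2 * v) * (4 * v)" by (simp add: power2_eq_square)
  moreover have "4 * v \<noteq> 0" using v by (rule four_mult_neq_0)
  ultimately show ?thesis by (simp add: t_def)
qed

text \<open>Completing the square: as \<open>tr (L z * z) = 2 * v\<close>, subtracting
  \<open>s / (2 * v)\<close> times \<open>z\<close> cancels the linear value \<open>s\<close> and
  lowers \<open>Q\<close> by \<open>s ^ 2 / (4 * v)\<close>.\<close>

lemma card_level_shift:
  assumes v: "Q z = v" "v \<noteq> 0"
  shows "card {y. tr (L z * y) = s \<and> Q y = b} = card {y. tr (L z * y) = 0 \<and> Q y = b - s\<^sup>2 / (4 * v)}"
proof (rule bij_betw_same_card)
  have tz: "tr (L z * z) = 2 * v" using tr_L_self v by simp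
  note sv = quarter_square[OF v(2)]
  define t where "t = s / (2 * v)"
  have ts: "s = t * (2 * v)" using v two_neq_0 by (simp add: t_def)
  have trt: "tr (L z * (emb t * z)) = s" using tr_scale[of t "L z * z"] tz ts by (simp add: mult_ac)
  have Qt: "Q (emb t * z + y) = t\<^sup>2 * v + Q y + t * tr (L z * y)" for y
    unfolding Q_add L_scale Q_scale v(1) using tr_scale[of t "L z * y"] by (simp add: mult_ac)
  show "bij_betw (\<lambda>y. y - emb t * z) {y. tr (L z * y) = s \<and> Q y = b} {y. tr (L z * y) = 0 \<and> Q y = b - s\<^sup>2 / (4 * v)}"
  proof (rule bij_betwI[of _ _ _ "\<lambda>y. emb t * z + y"])
    show "(\<lambda>y. y - emb t * z) \<in> {y. tr (L z * y) = s \<and> Q y = b} \<rightarrow> {y. tr (L z * y) = 0 \<and> Q y = b - s\<^sup>2 / (4 * v)}"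
    proof
      fix y assume y: "y \<in> {y. tr (L z * y) = s \<and> Q y = b}"
      have 1: "tr (L z * (y - emb t * z)) = 0" unfolding right_diff_distrib using trt y by simp
      have "Q y = t\<^sup>2 * v + Q (y - emb t * z)" using Qt[of "y - emb t * z"] 1 by simp
      hence "Q (y - emb t * z) = b - s\<^sup>2 / (4 * v)" using y sv[of s] by (simp add: eq_diff_eq add.commute t_def)
      thus "y - emb t * z \<in> {y. tr (L z * y) = 0 \<and> Q y = b - s\<^sup>2 / (4 * v)}" using 1 by simp
    qed
    show "(\<lambda>y. emb t * z + y) \<in> {y. tr (L z * y) = 0 \<and> Q y = b - s\<^sup>2 / (4 * v)} \<rightarrow> {y. tr (L z * y) = s \<and> Q y = b}"
    proof
      fix y assume y: "y \<in> {y. tr (L z * y) = 0 \<and> Q y = b - s\<^sup>2 / (4 * v)}"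
      have 1: "tr (L z * (emb t * z + y)) = s" unfolding distrib_left using trt y by simp
      show "emb t * z + y \<in> {y. tr (L z * y) = s \<and> Q y = b}" using 1 y sv[of s] Qt[of y] by (simp add: t_def)
    qed
  qed auto
qed

text \<open>Slicing the level of \<open>b\<close> by the value of \<open>tr (L z * y)\<close> and
  completing the square in each slice writes \<open>N b\<close> as a sum of hyperplane counts at the
  arguments \<open>u ^ 2 - b / v\<close>. The choices \<open>b = 0\<close> and \<open>b = v\<close>,
  together with the size of the hyperplane, supply the three sums for
  \<open>square_invariant_unique\<close>; the normalisation \<open>- v * w\<close> is made for this
  purpose.\<close>

lemma card_hyperplane_level:
  assumes v: "Q z = v" "v \<noteq> 0"
  shows "int (card {y. tr (L z * y) = 0 \<and> Q y = - v * w}) = int (p ^ (e - 2)) - legendre w * int K"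
proof -
  define P where "P w = int (card {y. tr (L z * y) = 0 \<and> Q y = - v * w})" for w
  have tz: "tr (L z * z) = 2 * v" using tr_L_self v by simp
  note sv = quarter_square[OF v(2)] and shift = card_level_shift[OF v]
  have N_sum_P: "int (N b) = (\<Sum>u\<in>UNIV. P (u\<^sup>2 - b / v))" for b
  proof -
    have "N b = card (\<Union>s\<in>UNIV. {y. tr (L z * y) = s \<and> Q y = b})"
      unfolding N_def by (rule arg_cong[of _ _ card]) auto
    also have "\<dots> = (\<Sum>s\<in>UNIV. card {y. tr (L z * y) = s \<and> Q y = b})"
      by (rule card_UN_disjoint) auto
    also have "\<dots> = (\<Sum>s\<in>UNIV. card {y. tr (L z * y) = 0 \<and> Q y = b - s\<^sup>2 / (4 * v)})"
      by (intro sum.cong refl shift)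
    also have "\<dots> = (\<Sum>u\<in>UNIV. card {y. tr (L z * y) = 0 \<and> Q y = - v * (u\<^sup>2 - b / v)})"
    proof (rule sum.reindex_bij_witness[of _ "\<lambda>u. 2 * v * u" "\<lambda>s. s / (2 * v)"])
      fix s :: "'p mod_ring"
      have "- v * ((s / (2 * v))\<^sup>2 - b / v) = b - s\<^sup>2 / (4 * v)"
        unfolding sv right_diff_distrib using v by simp
      thus "card {y. tr (L z * y) = 0 \<and> Q y = - v * ((s / (2 * v))\<^sup>2 - b / v)} = 
        card {y. tr (L z * y) = 0 \<and> Q y = b - s\<^sup>2 / (4 * v)}" by simp
    qed (use v two_neq_0 in auto)
    finally show ?thesis by (simp add: P_def)
  qed
  have "e - 1 = Suc (e - 2)" using e_eq m_pos by linarith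
  hence pe: "p * p ^ (e - 2) = p ^ (e - 1)" by simp
  have "P w = int (p ^ (e - 2)) - legendre w * int K"
  proof (rule square_invariant_unique)
    fix k w :: "'p mod_ring" assume k: "k \<noteq> 0"
    have "bij_betw ((*) (emb k)) {y. tr (L z * y) = 0 \<and> Q y = - v * w} {y. tr (L z * y) = 0 \<and> Q y = - v * (k\<^sup>2 * w)}"
    proof (rule bij_betwI[of _ _ _ "(*) (emb (1 / k))"])
      have tk: "tr (L z * (emb j * y)) = j * tr (L z * y)" for j y
        using tr_scale[of j "L z * y"] by (simp add: mult_ac)
      show "(*) (emb k) \<in> {y. tr (L z * y) = 0 \<and> Q y = - v * w} \<rightarrow> {y. tr (L z * y) = 0 \<and> Q y = - v * (k\<^sup>2 * w)}"
        by (auto simp: tk Q_scale)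
      show "(*) (emb (1 / k)) \<in> {y. tr (L z * y) = 0 \<and> Q y = - v * (k\<^sup>2 * w)} \<rightarrow> {y. tr (L z * y) = 0 \<and> Q y = - v * w}"
        using k by (auto simp: tk Q_scale power2_eq_square)
    qed (use k in \<open>simp_all add: mult.assoc[symmetric] emb_hom(5)[symmetric] del: emb_hom(5)\<close>)
    from bij_betw_same_card[OF this] show "P (k\<^sup>2 * w) = P w" by (simp only: P_def)
  next
    show "(\<Sum>u\<in>UNIV. P (u\<^sup>2)) = int CARD('p) * int (p ^ (e - 2)) - (int CARD('p) - 1) * int K"
      using N_sum_P[of 0] N_0 unfolding card_p of_nat_mult[symmetric] pe by simp
  next
    show "(\<Sum>u\<in>UNIV. P (u\<^sup>2 - 1)) = int CARD('p) * int (p ^ (e - 2)) + int K"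
      using N_sum_P[of v] N_neq_0[of v] v unfolding card_p of_nat_mult[symmetric] pe by simp
  next
    have Lz: "L z \<noteq> 0" using tz v two_neq_0 by auto
    have "(\<Sum>w\<in>UNIV. P w) = int (\<Sum>w\<in>UNIV. card {y. tr (L z * y) = 0 \<and> Q y = - v * w})" by (simp add: P_def)
    also have "(\<Sum>w\<in>UNIV. card {y. tr (L z * y) = 0 \<and> Q y = - v * w}) = card (\<Union>w\<in>UNIV. {y. tr (L z * y) = 0 \<and> Q y = - v * w})"
      by (rule card_UN_disjoint[symmetric]) (use v in auto)
    also have "(\<Union>w\<in>UNIV. {y. tr (L z * y) = 0 \<and> Q y = - v * w}) = {y. tr (L z * y) = 0}"
    proof -
      have "Q y = - v * (- Q y / v)" for y using v by simp
      thus ?thesis by blast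
    qed
    also have "card \<dots> = p ^ (e - 1)" using Lz by (rule card_tr_fibre')
    finally show "(\<Sum>w\<in>UNIV. P w) = int CARD('p) * int (p ^ (e - 2))"
      unfolding card_p of_nat_mult[symmetric] pe .
  qed
  thus ?thesis by (simp add: P_def)
qed

section \<open>Joint distribution of the form and a linear functional\<close>

definition cnt :: "'p mod_ring \<Rightarrow> 'q \<Rightarrow> 'p mod_ring \<Rightarrow> nat" where
  "cnt a x s = card {y. Q y = a \<and> tr (x * y) = s}"

lemma m_ge: "m \<ge> 2 * d" using m_eq h_pos by (cases h) auto

lemma p_power_e: "p * p ^ (e - 2) = p ^ (e - 1)"
proof -
  have "e - 1 = Suc (e - 2)" using e_eq m_pos by linarith
  thus ?thesis by simp
qed

lemma p_power_K: "p * p ^ (m + d - 2) = K"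
proof -
  have "m + d - 1 = Suc (m + d - 2)" using m_pos d_pos by linarith
  thus ?thesis by (simp add: K_def)
qed

text \<open>The first factor is \<open>card R\<close>, so the second will be the size of the image
  of the level under \<open>L\<close>. The bound \<open>m_ge\<close> keeps the exponents from being
  truncated.\<close>

lemma N_split: "v \<noteq> 0 \<Longrightarrow> N v = p ^ (2 * d) * (p ^ (e - 2 * d - 1) + p ^ (m - d - 1))"
proof -
  have "e - 1 = 2 * d + (e - 2 * d - 1)" "m + d - 1 = 2 * d + (m - d - 1)"
    using e_eq m_ge d_pos by linarith+
  hence "p ^ (e - 1) = p ^ (2 * d) * p ^ (e - 2 * d - 1)" "p ^ (m + d - 1) = p ^ (2 * d) * p ^ (m - d - 1)"
    by (metis power_add)+
  thus "v \<noteq> 0 \<Longrightarrow> ?thesis" unfolding N_neq_0 K_def by (simp add: distrib_left)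
qed

text \<open>Some direction in the radical changes the functional but preserves every level of
  \<open>Q\<close>, so the functional is equidistributed on the level.\<close>

lemma cnt_generic:
  assumes x: "x \<notin> range L" and a: "a \<noteq> 0"
  shows "cnt a x s = p ^ (e - 2) + p ^ (m + d - 2)"
proof -
  obtain u where u: "u \<in> R" "tr (x * u) \<noteq> 0" using tr_nonzero_on_R[OF x] by blast
  have "p * card {y \<in> {y. Q y = a}. tr (x * y) = s} = card {y. Q y = a}"
  proof (rule card_fibre_of_shift[of _ u _ "tr (x * u)"])
    fix t y assume y: "y \<in> {y. Q y = a}"
    have "emb t * u \<in> R" using u by (simp add: R_def L_scale)
    thus "y + emb t * u \<in> {y. Q y = a}" using y by (simp add: Q_add_R)
    show "tr (x * (y + emb t * u)) = tr (x * y) + t * tr (x * u)"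
      using tr_scale[of t "x * u"] by (simp add: algebra_simps)
  qed (use u in auto)
  hence "p * cnt a x s = N a" by (simp add: cnt_def N_def)
  also have "\<dots> = p * (p ^ (e - 2) + p ^ (m + d - 2))"
    using N_neq_0[OF a] p_power_e p_power_K by (simp add: distrib_left)
  finally show ?thesis using p_pos by simp
qed

lemma sum_cnt: "(\<Sum>s\<in>UNIV. cnt a x s) = N a"
proof -
  have "(\<Sum>s\<in>UNIV. cnt a x s) = card (\<Union>s\<in>UNIV. {y. Q y = a \<and> tr (x * y) = s})"
    unfolding cnt_def by (rule card_UN_disjoint[symmetric]) auto
  also have "(\<Union>s\<in>UNIV. {y. Q y = a \<and> tr (x * y) = s}) = {y. Q y = a}" by auto
  finally show ?thesis by (simp add: N_def)
qed

text \<open>Along \<open>z\<close> the functional is constant while \<open>Q\<close> changes at the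
  rate \<open>s\<close>. So \<open>Q\<close> is equidistributed on each slice with \<open>s\<close>
  nonzero, and the slice \<open>s = 0\<close> receives the rest of the level.\<close>

lemma cnt_isotropic:
  assumes z: "Q z = 0" "L z \<noteq> 0" and a: "a \<noteq> 0"
  shows "cnt a (L z) s = p ^ (e - 2) + (if s = 0 then K else 0)"
proof -
  have nz: "cnt a (L z) s = p ^ (e - 2)" if s: "s \<noteq> 0" for s
  proof -
    have "p * card {y \<in> {y. tr (L z * y) = s}. Q y = a} = card {y. tr (L z * y) = s}"
    proof (rule card_fibre_of_shift[of _ z _ s])
      fix t y assume y: "y \<in> {y. tr (L z * y) = s}"
      have "tr (L z * (emb t * z)) = 0" 
        using tr_scale[of t "L z * z"] tr_L_self[of z] z by (simp add: mult_ac)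
      thus "y + emb t * z \<in> {y. tr (L z * y) = s}" using y by (simp add: distrib_left)
      have "Q (emb t * z + y) = Q y + t * tr (L z * y)"
        unfolding Q_add L_scale Q_scale z(1) using tr_scale[of t "L z * y"] by (simp add: mult_ac)
      thus "Q (y + emb t * z) = Q y + t * s" using y by (simp add: add.commute)
    qed (rule s)
    hence "p * cnt a (L z) s = p ^ (e - 1)" 
      unfolding cnt_def card_tr_fibre'[OF z(2)] by (simp add: conj_commute)
    thus ?thesis using p_power_e p_pos by (metis mult_left_cancel less_irrefl)
  qed
  have "p ^ (e - 1) + K = cnt a (L z) 0 + (p - 1) * p ^ (e - 2)"
    using sum_mod_ring[of "cnt a (L z)" "p ^ (e - 2)", OF nz] N_neq_0[OF a] by (simp add: sum_cnt)
  moreover have "p ^ (e - 1) = p ^ (e - 2) + (p - 1) * p ^ (e - 2)"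
    using p_power_e p_pos by (cases p) auto
  ultimately show ?thesis using nz[of s] by auto
qed

text \<open>Completing the square leads to the hyperplane level \<open>a - s ^ 2 / (4 * v)\<close>.
  This is \<open>- v * w\<close>, where \<open>w\<close> is the discriminant divided by the nonzero
  square \<open>(2 * v) ^ 2\<close> and thus has the same Legendre symbol.\<close>

lemma cnt_anisotropic:
  assumes z: "Q z = v" "v \<noteq> 0"
  shows "int (cnt a (L z) s) = int (p ^ (e - 2)) - legendre (s\<^sup>2 - 4 * a * v) * int K"
proof -
  define w where "w = (s\<^sup>2 - 4 * a * v) / (2 * v)\<^sup>2"
  have v2: "2 * v \<noteq> 0" using z two_neq_0 by simp
  have w: "s\<^sup>2 - 4 * a * v = (2 * v)\<^sup>2 * w" 
    using power_not_zero[OF v2, of 2] by (metis nonzero_mult_div_cancel_left times_divide_eq_right w_def)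
  have lw: "legendre (s\<^sup>2 - 4 * a * v) = legendre w"
    unfolding w legendre_mult legendre_square[OF v2] by simp
  have "4 * v * (a - s\<^sup>2 / (4 * v)) = 4 * a * v - s\<^sup>2"
  proof -
    have "4 * v \<noteq> 0" using z(2) by (rule four_mult_neq_0)
    thus ?thesis unfolding right_diff_distrib by simp
  qed
  also have "\<dots> = 4 * v * (- v * w)" 
    using arg_cong[OF w, of uminus] by (simp add: power2_eq_square algebra_simps)
  finally have eq: "a - s\<^sup>2 / (4 * v) = - v * w"
    using four_mult_neq_0[OF z(2)] by (metis mult_left_cancel)
  have "cnt a (L z) s = card {y. tr (L z * y) = 0 \<and> Q y = a - s\<^sup>2 / (4 * v)}"
    unfolding cnt_def using card_level_shift[OF z, of s a] by (simp add: conj_commute)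
  thus ?thesis unfolding eq lw using card_hyperplane_level[OF z] by simp
qed

lemma cnt_le:
  assumes x: "x \<noteq> 0" and a: "a \<noteq> 0"
  shows "cnt a x s \<le> p ^ (e - 2) + K"
proof (cases "x \<in> range L")
  case False
  have "p ^ (m + d - 2) \<le> K" unfolding K_def using p_gt_1 by (intro power_increasing) auto
  thus ?thesis using cnt_generic[OF False a] by simp
next
  case True
  then obtain z where z: "x = L z" by auto
  show ?thesis
  proof (cases "Q z = 0")
    case True
    thus ?thesis using cnt_isotropic[of z] x z a by simp
  next
    case False
    have "- legendre (s\<^sup>2 - 4 * a * Q z) * int K \<le> 1 * int K"
      by (intro mult_right_mono) (use legendre_cases[of "s\<^sup>2 - 4 * a * Q z"] in auto)
    hence "int (cnt a x s) \<le> int (p ^ (e - 2) + K)"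
      using cnt_anisotropic[OF refl False, of a s] z by simp
    thus ?thesis by linarith
  qed
qed

text \<open>A functional given by a nonzero \<open>x\<close> is not constant on a nonzero level;
  this will make the codewords distinct.\<close>

lemma cnt_less:
  assumes x: "x \<noteq> 0" and a: "a \<noteq> 0"
  shows "cnt a x s < N a"
proof -
  have "p ^ (e - 2) < p ^ (e - 1)" using p_gt_1 e_eq m_pos by (intro power_strict_increasing) auto
  thus ?thesis using cnt_le[OF assms, of s] N_neq_0[OF a] by simp
qed

section \<open>Classes of the field with respect to the polar map\<close>

lemma L_eqD: "L z = L z' \<Longrightarrow> Q z = Q z'"
  using Q_add_R[of "z - z'" z'] by (simp add: R_def L_diff)

lemma card_L_level: "v \<noteq> 0 \<Longrightarrow> card (L ` {z. Q z = v}) = p ^ (e - 2 * d - 1) + p ^ (m - d - 1)"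
proof -
  assume v: "v \<noteq> 0"
  have "card (L ` {z. Q z = v}) * p ^ (2 * d) = N v"
    unfolding N_def by (rule card_L_image) (simp add: Q_add_R)
  hence "p ^ (2 * d) * card (L ` {z. Q z = v}) = p ^ (2 * d) * (p ^ (e - 2 * d - 1) + p ^ (m - d - 1))"
    using N_split[OF v] by (simp add: mult.commute)
  thus ?thesis using p_pos by simp
qed

lemma card_range_L: "card (range L) = p ^ (e - 2 * d)"
proof -
  have "card (range L) * p ^ (2 * d) = p ^ e" using card_L_image[of UNIV] card_ext by simp
  also have "p ^ e = p ^ (e - 2 * d) * p ^ (2 * d)" 
    using m_ge e_eq by (simp flip: power_add)
  finally show ?thesis using p_pos by simp
qed

lemma range_L_eq: "range L = (\<Union>v\<in>UNIV. L ` {z. Q z = v})" by auto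

lemma disjoint_L_levels: "v \<noteq> w \<Longrightarrow> L ` {z. Q z = v} \<inter> L ` {z. Q z = w} = {}"
  using L_eqD by blast

lemma card_L_level_0:
  "int (card (L ` {z. Q z = 0})) = int (p ^ (e - 2 * d - 1)) - (int p - 1) * int (p ^ (m - d - 1))"
proof -
  have "p ^ (e - 2 * d) = (\<Sum>v\<in>UNIV. card (L ` {z. Q z = v}))"
    unfolding card_range_L[symmetric] range_L_eq using disjoint_L_levels by (intro card_UN_disjoint) auto
  also have "\<dots> = card (L ` {z. Q z = 0}) + (p - 1) * (p ^ (e - 2 * d - 1) + p ^ (m - d - 1))"
    using sum_mod_ring[of "\<lambda>v. card (L ` {z. Q z = v})", OF card_L_level] by simp
  finally have "int (p ^ (e - 2 * d)) = int (card (L ` {z. Q z = 0})) 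
      + (int p - 1) * (int (p ^ (e - 2 * d - 1)) + int (p ^ (m - d - 1)))"
    using p_pos by (simp add: of_nat_diff)
  moreover have "e - 2 * d = Suc (e - 2 * d - 1)" using m_ge e_eq d_pos by linarith
  hence "int (p ^ (e - 2 * d)) = int p * int (p ^ (e - 2 * d - 1))" by (metis power_Suc of_nat_mult)
  ultimately show ?thesis by (simp add: algebra_simps)
qed

text \<open>The weight and the enumerator of a word depend only on the class of \<open>x\<close>:
  zero, outside \<open>range L\<close>, nonzero image of an isotropic vector, or image of a vector
  with a given nonzero value of \<open>Q\<close>. The general ring covers both rational
  multiplicities and polynomials.\<close>

lemma sum_over_classes:
  fixes f :: "'q \<Rightarrow> 'r::comm_ring_1"
  assumes fA: "\<And>x. x \<notin> range L \<Longrightarrow> f x = A"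
    and fB: "\<And>z. Q z = 0 \<Longrightarrow> L z \<noteq> 0 \<Longrightarrow> f (L z) = B"
    and fC: "\<And>z. Q z \<noteq> 0 \<Longrightarrow> f (L z) = C (Q z)"
  shows "(\<Sum>x\<in>UNIV. f x) = f 0 + (of_nat p ^ e - of_nat p ^ (e - 2 * d)) * A
    + (of_nat p ^ (e - 2 * d - 1) - (of_nat p - 1) * of_nat p ^ (m - d - 1) - 1) * B
    + (of_nat p ^ (e - 2 * d - 1) + of_nat p ^ (m - d - 1)) * (\<Sum>v\<in>UNIV - {0}. C v)"
proof -
  have "(\<Sum>x\<in>UNIV. f x) = (\<Sum>x\<in>UNIV - range L. f x) + (\<Sum>x\<in>range L. f x)"
    by (rule sum.subset_diff) auto
  also have "(\<Sum>x\<in>UNIV - range L. f x) = (\<Sum>x\<in>UNIV - range L. A)"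
    by (rule sum.cong) (use fA in auto)
  also have "\<dots> = of_nat (p ^ e - p ^ (e - 2 * d)) * A"
    by (simp add: card_Diff_subset card_ext card_range_L)
  also have "of_nat (p ^ e - p ^ (e - 2 * d)) = (of_nat p ^ e - of_nat p ^ (e - 2 * d) :: 'r)"
    using p_gt_1 by (subst of_nat_diff) (auto intro: power_increasing)
  also have "(\<Sum>x\<in>range L. f x) = (\<Sum>v\<in>UNIV. \<Sum>x\<in>L ` {z. Q z = v}. f x)"
    unfolding range_L_eq using disjoint_L_levels by (intro sum.UNION_disjoint) auto
  also have "\<dots> = (\<Sum>x\<in>L ` {z. Q z = 0}. f x) + (\<Sum>v\<in>UNIV - {0}. \<Sum>x\<in>L ` {z. Q z = v}. f x)"
    by (rule sum.remove) auto
  also have "(\<Sum>v\<in>UNIV - {0}. \<Sum>x\<in>L ` {z. Q z = v}. f x) = 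
     (\<Sum>v\<in>UNIV - {0}. (of_nat p ^ (e - 2 * d - 1) + of_nat p ^ (m - d - 1)) * C v)"
  proof (rule sum.cong)
    fix v :: "'p mod_ring" assume v: "v \<in> UNIV - {0}"
    have "(\<Sum>x\<in>L ` {z. Q z = v}. f x) = (\<Sum>x\<in>L ` {z. Q z = v}. C v)"
      by (rule sum.cong) (use fC v in auto)
    thus "(\<Sum>x\<in>L ` {z. Q z = v}. f x) = (of_nat p ^ (e - 2 * d - 1) + of_nat p ^ (m - d - 1)) * C v"
      using card_L_level[of v] v by simp
  qed simp
  also have "\<dots> = (of_nat p ^ (e - 2 * d - 1) + of_nat p ^ (m - d - 1)) * (\<Sum>v\<in>UNIV - {0}. C v)"
    by (rule sum_distrib_left[symmetric])
  \<comment> \<open>Zero is in the image of the zero level and is treated separately, hence the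
    \<open>- 1\<close> in the coefficient of \<open>B\<close>.\<close>
  also have "(\<Sum>x\<in>L ` {z. Q z = 0}. f x) = f 0 + (\<Sum>x\<in>L ` {z. Q z = 0} - {0}. f x)"
    by (rule sum.remove) (auto intro!: image_eqI[of _ _ 0])
  also have "(\<Sum>x\<in>L ` {z. Q z = 0} - {0}. f x) = (\<Sum>x\<in>L ` {z. Q z = 0} - {0}. B)"
    by (rule sum.cong) (use fB in auto)
  also have "\<dots> = of_int (int (card (L ` {z. Q z = 0})) - 1) * B"
  proof -
    have "0 \<in> L ` {z. Q z = 0}" by (auto intro!: image_eqI[of _ _ 0])
    moreover from this have "card (L ` {z. Q z = 0}) > 0" by (auto simp: card_gt_0_iff)
    ultimately show ?thesis by (simp add: card_Diff_singleton of_nat_diff Suc_leI)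
  qed
  also have "of_int (int (card (L ` {z. Q z = 0})) - 1) = 
     (of_nat p ^ (e - 2 * d - 1) - (of_nat p - 1) * of_nat p ^ (m - d - 1) - 1 :: 'r)"
    unfolding card_L_level_0 by simp
  finally show ?thesis by (simp only: add_ac)
qed

end

section \<open>The code\<close>

text \<open>Vectors correspond to coefficient functions on a finite basis, so the dimension of a
  finite space can be read off from its cardinality.\<close>

lemma (in vectorspace) card_carrier_eq_power_dim:
  assumes fin: "finite (carrier V)"
  shows "card (carrier V) = card (carrier K) ^ dim"
proof -
  have "gen_set (carrier V)" using in_own_span[of "carrier V"] span_is_subset2[of "carrier V"] by blast
  hence "fin_dim" unfolding fin_dim_def using fin by blast
  then obtain B where B: "finite B" "basis B" using finite_basis_exists by blast
  have BV: "B \<subseteq> carrier V" using B(2) by (simp add: basis_def)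
  have ex1: "\<exists>!a. a \<in> B \<rightarrow>\<^sub>E carrier K \<and> lincomb a B = v" if "v \<in> carrier V" for v
    using basis_criterion[OF B(1) BV] B(2) that by blast
  have closed: "lincomb a B \<in> carrier V" if "a \<in> B \<rightarrow>\<^sub>E carrier K" for a
    by (rule lincomb_closed[OF BV]) (use that in \<open>auto simp: PiE_def\<close>)
  have "bij_betw (\<lambda>a. lincomb a B) (B \<rightarrow>\<^sub>E carrier K) (carrier V)"
    unfolding bij_betw_def
  proof
    show "inj_on (\<lambda>a. lincomb a B) (B \<rightarrow>\<^sub>E carrier K)"
      using ex1 closed by (intro inj_onI) blast
    show "(\<lambda>a. lincomb a B) ` (B \<rightarrow>\<^sub>E carrier K) = carrier V"
      using ex1 closed by blast
  qed
  from bij_betw_same_card[OF this] have "card (carrier V) = card (B \<rightarrow>\<^sub>E carrier K)" ..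
  also have "\<dots> = card (carrier K) ^ card B" using B(1) by (simp add: card_PiE)
  also have "card B = dim" using dim_basis[OF B] ..
  finally show ?thesis .
qed

lemma card_nth_eq:
  assumes "distinct xs"
  shows "card {k. k < length xs \<and> P (xs ! k)} = card {x \<in> set xs. P x}"
proof -
  have "bij_betw ((!) xs) {k. k < length xs \<and> P (xs ! k)} {x \<in> set xs. P x}"
    unfolding bij_betw_def using assms by (auto simp: inj_on_def nth_eq_iff_index_eq in_set_conv_nth image_iff)
  from bij_betw_same_card[OF this] show ?thesis .
qed

lemma cwe_word_alt: 
  "cwe_word v = (\<Prod>j\<in>UNIV. unknown (j + c) ^ card {k. k < dim_vec v \<and> v $ k = j + (c :: 'a::{finite,ab_group_add})})"
  unfolding cwe_word_def
  by (rule prod.reindex_bij_witness[of _ "\<lambda>j. j + c" "\<lambda>i. i - c"]) auto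

lemma hamming_weight_alt:
  "hamming_weight v = dim_vec v - card {k. k < dim_vec v \<and> v $ k = 0}"
proof -
  have "{k. k < dim_vec v \<and> v $ k \<noteq> 0} = {..<dim_vec v} - {k. k < dim_vec v \<and> v $ k = 0}" by auto
  moreover have "card ({..<dim_vec v} - {k. k < dim_vec v \<and> v $ k = 0}) = 
      card {..<dim_vec v} - card {k. k < dim_vec v \<and> v $ k = 0}"
    by (rule card_Diff_subset) auto
  ultimately show ?thesis by (simp add: hamming_weight_def)
qed

section \<open>Words and the subspace they generate\<close>

locale gold_code = gold_form p e prime_type ext_type m \<alpha> d r h
  for p e :: nat and prime_type :: "'p::prime_card itself" and ext_type :: "'q::{finite,field} itself"
    and m \<alpha> d r h :: nat +
  fixes a c :: "'p mod_ring" and ds :: "'q list"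
  assumes a: "a \<noteq> 0" and c: "c \<noteq> 0"
    and distinct_ds: "distinct ds" and set_ds: "set ds = {y. Q y = a}"
begin

definition n :: nat where "n = p ^ (e - 1) + K"

text \<open>The constant \<open>t\<close> is left free because the generated subspace contains the
  words for all constants; the code itself has \<open>t = c\<close>.\<close>

definition word :: "'q \<Rightarrow> 'p mod_ring \<Rightarrow> 'p mod_ring vec" where
  "word x t = vec_of_list (map (\<lambda>y. tr (x * y) + t) ds)"

lemma length_ds: "length ds = n"
  using distinct_card[OF distinct_ds] set_ds N_neq_0[OF a] by (simp add: N_def n_def)

lemma dim_word [simp]: "dim_vec (word x t) = n"
  by (simp add: word_def length_ds)

lemma word_carrier [simp]: "word x t \<in> carrier_vec n"
  by (rule carrier_vecI) simp

lemma word_index [simp]: "k < n \<Longrightarrow> word x t $ k = tr (x * ds ! k) + t"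
  by (simp add: word_def length_ds vec_of_list_index)

lemma code_D_eq: "code_D e ds c = range (\<lambda>x. word x c)"
  by (simp add: code_D_def word_def)

lemma card_word: "card {k. k < n \<and> word x t $ k = s} = cnt a x (s - t)"
proof -
  have "{k. k < n \<and> word x t $ k = s} = {k. k < length ds \<and> tr (x * ds ! k) = s - t}"
    by (auto simp: length_ds eq_diff_eq)
  also have "card \<dots> = card {y \<in> set ds. tr (x * y) = s - t}" by (rule card_nth_eq[OF distinct_ds])
  finally show ?thesis by (simp add: cnt_def set_ds)
qed

text \<open>Equal words make \<open>tr ((x - x') * y)\<close> constant on the defining set, which
  \<open>cnt_less\<close> rules out unless \<open>x = x'\<close>. The constants then agree since the
  defining set is nonempty.\<close>

lemma word_eq_iff: "word x t = word x' t' \<longleftrightarrow> x = x' \<and> t = t'"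
proof
  assume eq: "word x t = word x' t'"
  have const: "tr ((x - x') * y) = t' - t" if y: "y \<in> set ds" for y
  proof -
    obtain k where k: "k < n" "ds ! k = y" using y by (auto simp: in_set_conv_nth length_ds)
    have "tr (x * y) + t = tr (x' * y) + t'" using arg_cong[OF eq, of "\<lambda>v. v $ k"] k by simp
    hence "tr (x * y) - tr (x' * y) = t' - t" by (simp add: algebra_simps)
    thus ?thesis by (simp add: left_diff_distrib)
  qed
  hence "{y. Q y = a \<and> tr ((x - x') * y) = t' - t} = {y. Q y = a}" using set_ds by auto
  hence "cnt a (x - x') (t' - t) = N a" by (simp add: cnt_def N_def)
  hence x: "x = x'" using cnt_less[of "x - x'" a "t' - t"] a by auto
  have "N a > 0" using N_neq_0[OF a] p_pos by simp
  then obtain y where "Q y = a" unfolding N_def by (metis (mono_tags, lifting) card.empty empty_Collect_eq less_irrefl)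
  thus "x = x' \<and> t = t'" using const[of y] x set_ds by simp
qed simp

lemma word_add: "word x t + word x' t' = word (x + x') (t + t')"
  by (rule eq_vecI) (simp_all add: distrib_right)

lemma word_smult: "k \<cdot>\<^sub>v word x t = word (emb k * x) (k * t)"
  by (rule eq_vecI) (simp_all add: mult.assoc distrib_left)

lemma word_0: "word 0 0 = 0\<^sub>v n"
  by (rule eq_vecI) simp_all

text \<open>The code contains \<open>word 0 c\<close>, whose entries all equal the nonzero
  \<open>c\<close>; adding multiples of it changes the constant of a word arbitrarily.\<close>

lemma code_span_eq: "code_span n (code_D e ds c) = range (case_prod word)"
proof -
  interpret V: vec_space "TYPE('p mod_ring)" n .
  let ?C = "code_D e ds c" and ?W = "range (case_prod word)"
  have W: "word x t \<in> ?W" for x t by (rule range_eqI[of _ _ "(x, t)"]) simp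
  have sub: "submodule class_ring ?W V.V"
  proof
    show "?W \<subseteq> carrier V.V" by auto
    show "v \<oplus>\<^bsub>V.V\<^esub> w \<in> ?W" if "v \<in> ?W" "w \<in> ?W" for v w
      using that W by (auto simp: word_add module_vec_simps)
    show "\<zero>\<^bsub>V.V\<^esub> \<in> ?W" using W[of 0 0] by (simp add: module_vec_simps word_0)
    show "k \<odot>\<^bsub>V.V\<^esub> v \<in> ?W" if "k \<in> carrier class_ring" "v \<in> ?W" for k v
      using that W by (auto simp: word_smult module_vec_simps)
  qed
  have CW: "?C \<subseteq> ?W" using W by (auto simp: code_D_eq)
  have C: "?C \<subseteq> carrier_vec n" by (auto simp: code_D_eq)
  have "V.span ?C \<subseteq> ?W" by (rule V.span_is_subset[OF CW sub])
  moreover have "?W \<subseteq> V.span ?C"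
  proof
    fix v assume "v \<in> ?W"
    then obtain x t where v: "v = word x t" by auto
    have sp: "submodule class_ring (V.span ?C) V.V" using V.span_is_submodule[of ?C] C by simp
    have in_span: "word x c \<in> V.span ?C" for x
      using V.in_own_span[of ?C] C by (auto simp: code_D_eq)
    have "((t - c) / c) \<cdot>\<^sub>v word 0 c \<in> V.span ?C"
      using submodule.smult_closed[OF sp, of "(t - c) / c" "word 0 c"] in_span by (simp add: class_ring_simps)
    hence "word x c + ((t - c) / c) \<cdot>\<^sub>v word 0 c \<in> V.span ?C"
      using submodule.m_closed[OF sp] in_span[of x] by simp
    moreover have "word x c + ((t - c) / c) \<cdot>\<^sub>v word 0 c = v"
      using c by (simp add: word_smult word_add v)
    ultimately show "v \<in> V.span ?C" by simp
  qed
  ultimately show ?thesis unfolding code_span_def by blast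
qed

text \<open>By \<open>word_eq_iff\<close> the span has \<open>p ^ (e + 1)\<close> elements, and the
  cardinality determines the dimension.\<close>

lemma linear_code_span: "linear_code n (e + 1) (code_span n (code_D e ds c))"
proof -
  interpret V: vec_space "TYPE('p mod_ring)" n .
  let ?C = "code_D e ds c"
  have C: "?C \<subseteq> carrier_vec n" by (auto simp: code_D_eq)
  have sub: "VectorSpace.subspace class_ring (code_span n ?C) V.V"
    unfolding code_span_def using V.span_is_subspace[of ?C] C by simp
  interpret S: vectorspace class_ring "V.V\<lparr>carrier := code_span n ?C\<rparr>"
    by (rule V.subspace_is_vs[OF sub])
  have car: "carrier (V.V\<lparr>carrier := code_span n ?C\<rparr>) = range (case_prod word)"
    by (simp add: code_span_eq)
  have "card (range (case_prod word)) = card (UNIV :: ('q \<times> 'p mod_ring) set)"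
    by (rule card_image) (auto simp: inj_on_def word_eq_iff)
  hence "card (range (case_prod word)) = p ^ (e + 1)"
    by (simp add: card_cartesian_product card_ext card_p flip: UNIV_Times_UNIV)
  moreover have "card (carrier (V.V\<lparr>carrier := code_span n ?C\<rparr>)) = card (carrier (class_ring :: 'p mod_ring ring)) ^ S.dim"
    by (rule S.card_carrier_eq_power_dim) (simp only: car finite_imageI[OF finite])
  ultimately have "p ^ (e + 1) = p ^ S.dim" unfolding car by (simp add: class_ring_simps card_p)
  hence "S.dim = e + 1" using p_gt_1 by (metis power_inject_exp)
  thus ?thesis unfolding linear_code_def using sub by simp
qed

section \<open>The weight distribution\<close>

lemma sum_code: "(\<Sum>v\<in>code_D e ds c. f v) = (\<Sum>x\<in>UNIV. f (word x c))"
  unfolding code_D_eq by (rule sum.reindex[unfolded comp_def]) (auto simp: inj_on_def word_eq_iff)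

lemma cnt_0: "cnt a 0 s = (if s = 0 then n else 0)"
  using N_neq_0[OF a] by (auto simp: cnt_def N_def n_def)

lemma hamming_weight_word: "hamming_weight (word x c) = n - cnt a x (- c)"
  unfolding hamming_weight_alt dim_word card_word by simp

lemma p_power_e_1: "p ^ (e - 1) = p ^ (e - 2) + (p - 1) * p ^ (e - 2)"
  using p_power_e p_pos by (cases p) auto

lemma K_split: "K = p ^ (m + d - 2) + (p - 1) * p ^ (m + d - 2)"
  using p_power_K p_pos by (cases p) auto

lemma weight_distribution:
  "has_weight_distribution (code_D e ds c)
     [((p - 1) * (p ^ (e - 2) + p ^ (m + d - 2)), of_nat p ^ e - of_nat p ^ (e - 2 * d)),
      ((p - 1) * p ^ (e - 2) + K, 2 * of_nat p ^ (e - 2 * d - 1) - (of_nat p - 2) * of_nat p ^ (m - d - 1) - 1),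
      ((p - 1) * p ^ (e - 2) + 2 * K, 1 / 2 * (of_nat p - 3) * (of_nat p ^ (e - 2 * d - 1) + of_nat p ^ (m - d - 1))),
      ((p - 1) * p ^ (e - 2), 1 / 2 * (of_nat p - 1) * (of_nat p ^ (e - 2 * d - 1) + of_nat p ^ (m - d - 1))),
      (n, 1)]"
  unfolding has_weight_distribution_def
proof
  fix w :: nat
  let ?t = "(p - 1) * p ^ (e - 2)"
  define f :: "'q \<Rightarrow> rat" where "f x = (if hamming_weight (word x c) = w then 1 else 0)" for x
  \<comment> \<open>Indicator that the weight belonging to the Legendre value \<open>l\<close> is
    \<open>w\<close>; the value \<open>l = 0\<close> also serves the nonzero images of isotropic
    vectors.\<close>
  define g :: "int \<Rightarrow> rat" where "g l = (if nat (int ?t + (1 + l) * int K) = w then 1 else 0)" for l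
  define A :: rat where "A = (if (p - 1) * (p ^ (e - 2) + p ^ (m + d - 2)) = w then 1 else 0)"
  define M where "M = (of_nat p ^ (e - 2 * d - 1) + of_nat p ^ (m - d - 1) :: rat)"
  have nat_weight: "nat (int ?t + (1 + 0) * int K) = ?t + K" "nat (int ?t + (1 + 1) * int K) = ?t + 2 * K"
    "nat (int ?t + (1 + - 1) * int K) = ?t"
  proof -
    have "int ?t + (1 + 0) * int K = int (?t + K)" "int ?t + (1 + 1) * int K = int (?t + 2 * K)"
      "int ?t + (1 + - 1) * int K = int ?t" by simp_all
    thus "nat (int ?t + (1 + 0) * int K) = ?t + K" "nat (int ?t + (1 + 1) * int K) = ?t + 2 * K"
      "nat (int ?t + (1 + - 1) * int K) = ?t" by (simp_all only: nat_int)
  qed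
  have "of_nat (card {v \<in> code_D e ds c. hamming_weight v = w}) = (\<Sum>v\<in>code_D e ds c. if hamming_weight v = w then 1 else 0 :: rat)"
  proof -
    have "finite (code_D e ds c)" unfolding code_D_eq by simp
    thus ?thesis by (simp add: sum.If_cases Int_def conj_commute)
  qed
  also have "\<dots> = (\<Sum>x\<in>UNIV. f x)" unfolding sum_code f_def ..
  also have "\<dots> = f 0 + (of_nat p ^ e - of_nat p ^ (e - 2 * d)) * A
    + (of_nat p ^ (e - 2 * d - 1) - (of_nat p - 1) * of_nat p ^ (m - d - 1) - 1) * g 0
    + (of_nat p ^ (e - 2 * d - 1) + of_nat p ^ (m - d - 1)) * (\<Sum>v\<in>UNIV - {0}. g (legendre (c\<^sup>2 - 4 * a * v)))"
  proof (rule sum_over_classes)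
    fix x assume "x \<notin> range L"
    hence "hamming_weight (word x c) = n - (p ^ (e - 2) + p ^ (m + d - 2))"
      unfolding hamming_weight_word using cnt_generic a by simp
    also have "\<dots> = (p - 1) * (p ^ (e - 2) + p ^ (m + d - 2))"
      unfolding n_def by (subst p_power_e_1, subst K_split) (simp add: distrib_left)
    finally show "f x = A" by (simp only: f_def A_def)
  next
    fix z assume "Q z = 0" "L z \<noteq> 0"
    hence "hamming_weight (word (L z) c) = n - p ^ (e - 2)"
      unfolding hamming_weight_word using cnt_isotropic a c by simp
    also have "\<dots> = ?t + K" unfolding n_def by (subst p_power_e_1) simp
    finally show "f (L z) = g 0" by (simp only: f_def g_def nat_weight)
  next
    fix z assume z: "Q z \<noteq> 0"
    let ?l = "legendre (c\<^sup>2 - 4 * a * Q z)"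
    have "int (cnt a (L z) (- c)) = int (p ^ (e - 2)) - ?l * int K"
      using cnt_anisotropic[OF refl z, of a "- c"] by simp
    moreover have "L z \<noteq> 0" using z L_eqD[of z 0] by auto
    \<comment> \<open>This bound makes the natural subtraction in the weight exact.\<close>
    hence "cnt a (L z) (- c) < n" using cnt_less[OF _ a, of "L z" "- c"] N_neq_0[OF a] by (simp add: n_def)
    ultimately have "int (hamming_weight (word (L z) c)) = int n - (int (p ^ (e - 2)) - ?l * int K)"
      unfolding hamming_weight_word by (simp add: of_nat_diff)
    also have "int n = int (p ^ (e - 2)) + int ?t + int K"
      unfolding n_def by (subst p_power_e_1) simp
    finally have "int (hamming_weight (word (L z) c)) = int ?t + (1 + ?l) * int K" by (simp add: algebra_simps)
    hence "hamming_weight (word (L z) c) = nat (int ?t + (1 + ?l) * int K)" by (metis nat_int)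
    thus "f (L z) = g ?l" by (simp only: f_def g_def)
  qed
  \<comment> \<open>As \<open>v\<close> runs through the whole field, so does
    \<open>c ^ 2 - 4 * a * v\<close>. Omitting \<open>v = 0\<close> omits the nonzero square
    \<open>c ^ 2\<close>, hence the term \<open>- g 1\<close>.\<close>
  also have "(\<Sum>v\<in>UNIV - {0}. g (legendre (c\<^sup>2 - 4 * a * v))) = g 0 + (of_nat p - 1) / 2 * (g 1 + g (-1)) - g 1"
  proof -
    have a4: "4 * a \<noteq> 0" using a by (rule four_mult_neq_0)
    have "(\<Sum>v\<in>UNIV. g (legendre (c\<^sup>2 - 4 * a * v))) = (\<Sum>x\<in>UNIV. g (legendre (x :: 'p mod_ring)))"
      by (rule sum.reindex_bij_witness[of _ "\<lambda>x. (c\<^sup>2 - x) / (4 * a)" "\<lambda>v. c\<^sup>2 - 4 * a * v"])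
        (use a4 in \<open>simp_all del: mult_eq_0_iff\<close>)
    also have "\<dots> = g 0 + (of_nat p - 1) / 2 * (g 1 + g (-1))" by (simp only: sum_legendre_comp card_p)
    also have "(\<Sum>v\<in>UNIV. g (legendre (c\<^sup>2 - 4 * a * v))) = g 1 + (\<Sum>v\<in>UNIV - {0}. g (legendre (c\<^sup>2 - 4 * a * v)))"
      by (subst sum.remove[of _ 0]) (use legendre_square[OF c] in simp_all)
    finally show ?thesis by simp
  qed
  also have "f 0 = (if n = w then 1 else 0)"
    unfolding f_def hamming_weight_word cnt_0 using c by simp
  \<comment> \<open>The isotropic class and the zero of the discriminant give the same weight, so
    their coefficients are merged in front of \<open>g 0\<close>.\<close>
  finally have eq: "of_nat (card {v \<in> code_D e ds c. hamming_weight v = w}) =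
    (if n = w then 1 else 0) + (of_nat p ^ e - of_nat p ^ (e - 2 * d)) * A
    + (2 * of_nat p ^ (e - 2 * d - 1) - (of_nat p - 2) * of_nat p ^ (m - d - 1) - 1) * g 0
    + 1 / 2 * (of_nat p - 3) * M * g 1 + 1 / 2 * (of_nat p - 1) * M * g (-1)"
    by (simp add: M_def field_simps)
  have g: "g 0 = (if ?t + K = w then 1 else 0)" "g 1 = (if ?t + 2 * K = w then 1 else 0)" "g (-1) = (if ?t = w then 1 else 0)"
    by (simp_all only: g_def nat_weight)
  have ifm: "x * (if P then 1 else 0) = (if P then x else (0::rat))" for x P by simp
  show "of_nat (card {v \<in> code_D e ds c. hamming_weight v = w}) = (\<Sum>(u, mult)\<leftarrow>
     [((p - 1) * (p ^ (e - 2) + p ^ (m + d - 2)), of_nat p ^ e - of_nat p ^ (e - 2 * d)),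
      (?t + K, 2 * of_nat p ^ (e - 2 * d - 1) - (of_nat p - 2) * of_nat p ^ (m - d - 1) - 1),
      (?t + 2 * K, 1 / 2 * (of_nat p - 3) * (of_nat p ^ (e - 2 * d - 1) + of_nat p ^ (m - d - 1))),
      (?t, 1 / 2 * (of_nat p - 1) * (of_nat p ^ (e - 2 * d - 1) + of_nat p ^ (m - d - 1))),
      (n, 1 :: rat)]. if u = w then mult else 0)"
    unfolding eq g A_def M_def ifm list.map sum_list.Cons sum_list.Nil prod.case by (simp only: add_ac add_0_right)
qed

section \<open>The complete weight enumerator\<close>

lemma cwe_word_word:
  "cwe_word (word x c) = unknown c ^ cnt a x 0 * (\<Prod>j\<in>UNIV - {0}. unknown (j + c) ^ cnt a x j)"
proof -
  have "cwe_word (word x c) = (\<Prod>j\<in>UNIV. unknown (j + c) ^ cnt a x j)"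
    unfolding cwe_word_alt[of _ c] dim_word card_word by simp
  also have "\<dots> = unknown (0 + c) ^ cnt a x 0 * (\<Prod>j\<in>UNIV - {0}. unknown (j + c) ^ cnt a x j)"
    by (rule prod.remove) auto
  finally show ?thesis by simp
qed

lemma CWE_code:
  "CWE (code_D e ds c) =
     unknown c ^ n
   + (of_nat p ^ e - of_nat p ^ (e - 2 * d)) * (\<Prod>i\<in>UNIV. unknown i ^ (p ^ (e - 2) + p ^ (m + d - 2)))
   + (of_nat p ^ (e - 2 * d - 1) - (of_nat p - 1) * of_nat p ^ (m - d - 1) - 1) *
       (unknown c ^ (p ^ (e - 2) + K) * (\<Prod>i\<in>UNIV - {0}. unknown (i + c) ^ (p ^ (e - 2))))
   + (of_nat p ^ (e - 2 * d - 1) + of_nat p ^ (m - d - 1)) *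
       (\<Sum>i\<in>UNIV - {0}. unknown c ^ nat (int (p ^ (e - 2)) - legendre (- 1 :: 'p mod_ring) * legendre a * legendre i * int K) *
          (\<Prod>j\<in>UNIV - {0}. unknown (j + c) ^ nat (int (p ^ (e - 2)) - legendre (j\<^sup>2 - 4 * a * i) * int K)))"
proof -
  have "CWE (code_D e ds c) = (\<Sum>x\<in>UNIV. cwe_word (word x c))" unfolding CWE_def sum_code ..
  also have "\<dots> = cwe_word (word 0 c)
   + (of_nat p ^ e - of_nat p ^ (e - 2 * d)) * (\<Prod>i\<in>UNIV. unknown i ^ (p ^ (e - 2) + p ^ (m + d - 2)))
   + (of_nat p ^ (e - 2 * d - 1) - (of_nat p - 1) * of_nat p ^ (m - d - 1) - 1) *
       (unknown c ^ (p ^ (e - 2) + K) * (\<Prod>i\<in>UNIV - {0}. unknown (i + c) ^ (p ^ (e - 2))))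
   + (of_nat p ^ (e - 2 * d - 1) + of_nat p ^ (m - d - 1)) *
       (\<Sum>i\<in>UNIV - {0}. unknown c ^ nat (int (p ^ (e - 2)) - legendre (- 1 :: 'p mod_ring) * legendre a * legendre i * int K) *
          (\<Prod>j\<in>UNIV - {0}. unknown (j + c) ^ nat (int (p ^ (e - 2)) - legendre (j\<^sup>2 - 4 * a * i) * int K)))"
  proof (rule sum_over_classes)
    fix x assume "x \<notin> range L"
    thus "cwe_word (word x c) = (\<Prod>i\<in>UNIV. unknown i ^ (p ^ (e - 2) + p ^ (m + d - 2)))"
      unfolding cwe_word_def dim_word card_word using cnt_generic a by simp
  next
    fix z assume z: "Q z = 0" "L z \<noteq> 0"
    have "(\<Prod>j\<in>UNIV - {0}. unknown (j + c) ^ cnt a (L z) j) = (\<Prod>j\<in>UNIV - {0}. unknown (j + c) ^ (p ^ (e - 2)))"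
      by (rule prod.cong) (use cnt_isotropic[OF z a] in auto)
    thus "cwe_word (word (L z) c) = unknown c ^ (p ^ (e - 2) + K) * (\<Prod>j\<in>UNIV - {0}. unknown (j + c) ^ (p ^ (e - 2)))"
      unfolding cwe_word_word using cnt_isotropic[OF z a] by simp
  next
    fix z assume z: "Q z \<noteq> 0"
    \<comment> \<open>The integer inside \<open>nat\<close> equals a cardinality, so
      \<open>nat\<close> truncates nothing.\<close>
    have cnt: "cnt a (L z) j = nat (int (p ^ (e - 2)) - legendre (j\<^sup>2 - 4 * a * Q z) * int K)" for j
      using cnt_anisotropic[OF refl z, of a j] by (metis nat_int)
    have "0\<^sup>2 - 4 * a * Q z = - 1 * 2\<^sup>2 * a * Q z" by simp
    hence "legendre (0\<^sup>2 - 4 * a * Q z) = legendre (- 1 :: 'p mod_ring) * legendre a * legendre (Q z)"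
      unfolding legendre_mult using legendre_square[OF two_neq_0] by (simp only: legendre_mult mult_1_right)
    thus "cwe_word (word (L z) c) = unknown c ^ nat (int (p ^ (e - 2)) - legendre (- 1 :: 'p mod_ring) * legendre a * legendre (Q z) * int K) *
          (\<Prod>j\<in>UNIV - {0}. unknown (j + c) ^ nat (int (p ^ (e - 2)) - legendre (j\<^sup>2 - 4 * a * Q z) * int K))"
      unfolding cwe_word_word cnt by simp
  qed
  also have "cwe_word (word 0 c) = unknown c ^ n"
    unfolding cwe_word_word cnt_0 by simp
  finally show ?thesis .
qed

text \<open>For this value of \<open>i\<close> the discriminant \<open>j ^ 2 - 4 * a * i\<close>
  becomes \<open>j ^ 2 - c ^ 2\<close>, which is the summand written separately in the
  enumerator.\<close>

lemma discriminant_root: "4 * a * (inverse (4 * a) * c\<^sup>2) = c\<^sup>2"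
  using four_mult_neq_0[OF a] by (simp only: mult.assoc[symmetric] right_inverse mult_1_left not_False_eq_True)

text \<open>Four times the product of the two arguments is the nonzero square \<open>c ^ 2\<close>,
  so their symbols multiply to 1.\<close>

lemma legendre_discriminant_root: "legendre (inverse (4 * a) * c\<^sup>2) = legendre a"
proof -
  have "2\<^sup>2 * (a * (inverse (4 * a) * c\<^sup>2)) = c\<^sup>2"
    using discriminant_root by (simp only: mult.assoc power2_eq_square) simp
  hence "legendre a * legendre (inverse (4 * a) * c\<^sup>2) = 1"
    using legendre_square[OF c] legendre_square[OF two_neq_0] legendre_mult by (metis mult_1_left)
  thus ?thesis using legendre_cases[of a] legendre_cases[of "inverse (4 * a) * c\<^sup>2"] by auto
qed

lemma sum_split_legendre:
  fixes C :: "'p mod_ring \<Rightarrow> 'r::comm_ring_1"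
  shows "(\<Sum>i\<in>UNIV - {0}. C i) = C (inverse (4 * a) * c\<^sup>2)
    + (\<Sum>i\<in>{i. i \<noteq> 0 \<and> i \<noteq> inverse (4 * a) * c\<^sup>2 \<and> legendre i = legendre a}. C i)
    + (\<Sum>i\<in>{i. i \<noteq> 0 \<and> legendre i \<noteq> legendre a}. C i)"
proof -
  define b where "b = inverse (4 * a) * c\<^sup>2"
  have lb: "legendre b = legendre a" unfolding b_def by (rule legendre_discriminant_root)
  hence b0: "b \<noteq> 0" using a legendre_eq_0_iff by metis
  let ?S = "{i. i \<noteq> 0 \<and> i \<noteq> b \<and> legendre i = legendre a}" and ?T = "{i. i \<noteq> 0 \<and> legendre i \<noteq> legendre a}"
  have "UNIV - {0} = insert b (?S \<union> ?T)" using b0 lb by auto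
  hence "(\<Sum>i\<in>UNIV - {0}. C i) = (\<Sum>i\<in>insert b (?S \<union> ?T). C i)" by (simp only:)
  also have "(\<Sum>i\<in>insert b (?S \<union> ?T). C i) = C b + (\<Sum>i\<in>?S \<union> ?T. C i)"
    by (rule sum.insert) (use lb in auto)
  also have "(\<Sum>i\<in>?S \<union> ?T. C i) = (\<Sum>i\<in>?S. C i) + (\<Sum>i\<in>?T. C i)"
    by (rule sum.union_disjoint) auto
  finally show ?thesis by (simp only: b_def add.assoc)
qed

text \<open>The product of the symbols of \<open>a\<close> and \<open>i\<close> is 1 when they agree
  and -1 otherwise (for nonzero \<open>i\<close>). This turns the uniform exponent of
  \<open>unknown c\<close> in \<open>CWE_code\<close> into one with a minus sign and one with a plus
  sign.\<close>

lemma CWE_code_split: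
  "CWE (code_D e ds c) =
     unknown c ^ n
   + (of_nat p ^ e - of_nat p ^ (e - 2 * d)) * (\<Prod>i\<in>UNIV. unknown i ^ (p ^ (e - 2) + p ^ (m + d - 2)))
   + (of_nat p ^ (e - 2 * d - 1) - (of_nat p - 1) * of_nat p ^ (m - d - 1) - 1) *
       unknown c ^ (p ^ (e - 2) + K) * (\<Prod>i\<in>UNIV - {0}. unknown (i + c) ^ (p ^ (e - 2)))
   + (of_nat p ^ (e - 2 * d - 1) + of_nat p ^ (m - d - 1)) *
       unknown c ^ nat (int (p ^ (e - 2)) - legendre (- 1 :: 'p mod_ring) * int K) *
       (\<Prod>i\<in>UNIV - {0}. unknown (i + c) ^ nat (int (p ^ (e - 2)) - legendre (i\<^sup>2 - c\<^sup>2) * int K))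
   + (of_nat p ^ (e - 2 * d - 1) + of_nat p ^ (m - d - 1)) *
       (\<Sum>i\<in>{i. i \<noteq> 0 \<and> i \<noteq> inverse (4 * a) * c\<^sup>2 \<and> legendre i = legendre a}.
          unknown c ^ nat (int (p ^ (e - 2)) - legendre (- 1 :: 'p mod_ring) * int K) *
          (\<Prod>j\<in>UNIV - {0}. unknown (j + c) ^ nat (int (p ^ (e - 2)) - legendre (j\<^sup>2 - 4 * a * i) * int K)))
   + (of_nat p ^ (e - 2 * d - 1) + of_nat p ^ (m - d - 1)) *
       (\<Sum>i\<in>{i. i \<noteq> 0 \<and> legendre i \<noteq> legendre a}.
          unknown c ^ nat (int (p ^ (e - 2)) + legendre (- 1 :: 'p mod_ring) * int K) *
          (\<Prod>j\<in>UNIV - {0}. unknown (j + c) ^ nat (int (p ^ (e - 2)) - legendre (j\<^sup>2 - 4 * a * i) * int K)))"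
proof -
  let ?P = "\<lambda>i. \<Prod>j\<in>UNIV - {0}. unknown (j + c) ^ nat (int (p ^ (e - 2)) - legendre (j\<^sup>2 - 4 * a * i) * int K)"
  define C :: "'p mod_ring \<Rightarrow> 'p mod_ring enumerator" where
    "C i = unknown c ^ nat (int (p ^ (e - 2)) - legendre (- 1 :: 'p mod_ring) * legendre a * legendre i * int K) * ?P i" for i
  have la: "legendre a * legendre a = 1" using legendre_cases[of a] a by auto
  have Ceq: "C i = unknown c ^ nat (int (p ^ (e - 2)) - legendre (- 1 :: 'p mod_ring) * int K) * ?P i"
    if "legendre i = legendre a" for i
    unfolding C_def that mult.assoc[of "legendre (- 1)"] la by simp
  have Cneq: "C i = unknown c ^ nat (int (p ^ (e - 2)) + legendre (- 1 :: 'p mod_ring) * int K) * ?P i"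
    if "i \<noteq> 0" "legendre i \<noteq> legendre a" for i
  proof -
    have "legendre a * legendre i = -1"
      using legendre_cases[of a] legendre_cases[of i] a that by auto
    thus ?thesis unfolding C_def mult.assoc[of "legendre (- 1)"] by simp
  qed
  have "(\<Sum>i\<in>UNIV - {0}. C i) = C (inverse (4 * a) * c\<^sup>2)
    + (\<Sum>i\<in>{i. i \<noteq> 0 \<and> i \<noteq> inverse (4 * a) * c\<^sup>2 \<and> legendre i = legendre a}. C i)
    + (\<Sum>i\<in>{i. i \<noteq> 0 \<and> legendre i \<noteq> legendre a}. C i)"
    by (rule sum_split_legendre)
  also have "C (inverse (4 * a) * c\<^sup>2) = unknown c ^ nat (int (p ^ (e - 2)) - legendre (- 1 :: 'p mod_ring) * int K) *
     (\<Prod>i\<in>UNIV - {0}. unknown (i + c) ^ nat (int (p ^ (e - 2)) - legendre (i\<^sup>2 - c\<^sup>2) * int K))"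
    unfolding Ceq[OF legendre_discriminant_root] discriminant_root ..
  also have "(\<Sum>i\<in>{i. i \<noteq> 0 \<and> i \<noteq> inverse (4 * a) * c\<^sup>2 \<and> legendre i = legendre a}. C i) =
     (\<Sum>i\<in>{i. i \<noteq> 0 \<and> i \<noteq> inverse (4 * a) * c\<^sup>2 \<and> legendre i = legendre a}.
        unknown c ^ nat (int (p ^ (e - 2)) - legendre (- 1 :: 'p mod_ring) * int K) * ?P i)"
    by (rule sum.cong[OF refl], rule Ceq) blast
  also have "(\<Sum>i\<in>{i. i \<noteq> 0 \<and> legendre i \<noteq> legendre a}. C i) =
     (\<Sum>i\<in>{i. i \<noteq> 0 \<and> legendre i \<noteq> legendre a}.
        unknown c ^ nat (int (p ^ (e - 2)) + legendre (- 1 :: 'p mod_ring) * int K) * ?P i)"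
    by (rule sum.cong[OF refl], rule Cneq) blast+
  also note C = calculation
  show ?thesis unfolding CWE_code C_def[symmetric] C by (simp only: distrib_left mult.assoc add.assoc)
qed

end

theorem theorem2p4:
  fixes p m \<alpha> e q d :: nat
    and a c :: "'p::prime_card mod_ring"
    and ds :: "'q::{finite,field} list"
  assumes "prime p" and "odd p"
    and "m > 0" and "\<alpha> > 0"
    and "e = 2 * m" and "q = p ^ e" and "d = gcd \<alpha> e"
    and "CARD('p) = p" and "CARD('q) = q"
    and "d dvd m" and "even (m div d)"
    and "a \<noteq> 0" and "c \<noteq> 0"
    and "distinct ds" and "set ds = defining_set e \<alpha> a"
  shows "code_D e ds c \<subseteq> carrier_vec (p ^ (e - 1) + p ^ (m + d - 1)) \<and>
         linear_code (p ^ (e - 1) + p ^ (m + d - 1)) (e + 1)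
           (code_span (p ^ (e - 1) + p ^ (m + d - 1)) (code_D e ds c)) \<and>
         has_weight_distribution (code_D e ds c)
           [((p - 1) * (p ^ (e - 2) + p ^ (m + d - 2)),
               of_nat p ^ e - of_nat p ^ (e - 2 * d)),
            ((p - 1) * p ^ (e - 2) + p ^ (m + d - 1),
               2 * of_nat p ^ (e - 2 * d - 1) - (of_nat p - 2) * of_nat p ^ (m - d - 1) - 1),
            ((p - 1) * p ^ (e - 2) + 2 * p ^ (m + d - 1),
               1 / 2 * (of_nat p - 3) * (of_nat p ^ (e - 2 * d - 1) + of_nat p ^ (m - d - 1))),
            ((p - 1) * p ^ (e - 2),
               1 / 2 * (of_nat p - 1) * (of_nat p ^ (e - 2 * d - 1) + of_nat p ^ (m - d - 1))),
            (p ^ (e - 1) + p ^ (m + d - 1),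
               1)] \<and>
         CWE (code_D e ds c) =
           unknown c ^ (p ^ (e - 1) + p ^ (m + d - 1))
         + (of_nat p ^ e - of_nat p ^ (e - 2 * d)) *
             (\<Prod>i\<in>UNIV. unknown i ^ (p ^ (e - 2) + p ^ (m + d - 2)))
         + (of_nat p ^ (e - 2 * d - 1) - (of_nat p - 1) * of_nat p ^ (m - d - 1) - 1) *
             unknown c ^ (p ^ (e - 2) + p ^ (m + d - 1)) *
             (\<Prod>i\<in>UNIV - {0}. unknown (i + c) ^ (p ^ (e - 2)))
         + (of_nat p ^ (e - 2 * d - 1) + of_nat p ^ (m - d - 1)) *
             unknown c ^ nat (int (p ^ (e - 2)) - legendre (- 1 :: 'p mod_ring) * int (p ^ (m + d - 1))) *
             (\<Prod>i\<in>UNIV - {0}. unknown (i + c) ^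
                nat (int (p ^ (e - 2)) - legendre (i\<^sup>2 - c\<^sup>2) * int (p ^ (m + d - 1))))
         + (of_nat p ^ (e - 2 * d - 1) + of_nat p ^ (m - d - 1)) *
             (\<Sum>i\<in>{i. i \<noteq> 0 \<and> i \<noteq> inverse (4 * a) * c\<^sup>2 \<and> legendre i = legendre a}.
                unknown c ^ nat (int (p ^ (e - 2)) - legendre (- 1 :: 'p mod_ring) * int (p ^ (m + d - 1))) *
                (\<Prod>j\<in>UNIV - {0}. unknown (j + c) ^
                   nat (int (p ^ (e - 2)) - legendre (j\<^sup>2 - 4 * a * i) * int (p ^ (m + d - 1)))))
         + (of_nat p ^ (e - 2 * d - 1) + of_nat p ^ (m - d - 1)) *
             (\<Sum>i\<in>{i. i \<noteq> 0 \<and> legendre i \<noteq> legendre a}.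
                unknown c ^ nat (int (p ^ (e - 2)) + legendre (- 1 :: 'p mod_ring) * int (p ^ (m + d - 1))) *
                (\<Prod>j\<in>UNIV - {0}. unknown (j + c) ^
                   nat (int (p ^ (e - 2)) - legendre (j\<^sup>2 - 4 * a * i) * int (p ^ (m + d - 1)))))"
proof -
  obtain k where k: "m div d = 2 * k" using assms(11) by blast
  have m: "m = 2 * d * k" using assms(10) k by (metis dvd_mult_div_cancel mult.assoc mult.commute)
  have q: "CARD('q) = p ^ e" using assms(6,9) by simp
  have d0: "d > 0" using assms(3) m by (cases d) auto
  have \<alpha>: "\<alpha> = d * (\<alpha> div d)" using assms(7) by simp
  \<comment> \<open>The cofactors of \<open>d = gcd \<alpha> e\<close> are coprime, and
    \<open>m = 2 * d * k\<close> identifies the second one as \<open>4 * k\<close>; this is the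
    coprimality assumption of \<open>gold_form\<close>.\<close>
  have "e div d = 4 * k" using assms(5) m d0 by simp
  moreover have "coprime (\<alpha> div d) (e div d)"
    unfolding assms(7) using assms(4) by (intro div_gcd_coprime) auto
  ultimately have cop: "coprime (\<alpha> div d) (4 * k)" by simp
  interpret gold_form p e "TYPE('p)" "TYPE('q)" m \<alpha> d "\<alpha> div d" k
    by unfold_locales (fact assms q m \<alpha> cop)+
  have ds: "set ds = {y. Q y = a}"
    using assms(15) by (simp add: defining_set_def Q_def assms(8))
  interpret gold_code p e "TYPE('p)" "TYPE('q)" m \<alpha> d "\<alpha> div d" k a c ds
    by unfold_locales (fact assms ds)+
  have "code_D e ds c \<subseteq> carrier_vec n" by (auto simp: code_D_eq)
  thus ?thesis
    using linear_code_span weight_distribution CWE_code_split unfolding n_def K_def by blast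
qed

end
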